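(* There exist absolute constants $c, C > 0$ and $\epsilon_0 > 0$ such that for every $\epsilon \in (0, \epsilon_0)$ there is an infinite family $\mathcal{F}$ of Max-2-LIN$(\mathbb{Z}_2)$ instances on hypercubes (of varying dimensions) such that every $I \in \mathcal{F}$ has combinatorial value at least $c\,\epsilon$ and Goemans--Williamson SDP value at most $C\,\epsilon^{3/2}$. (In the paper's terminology: for every sufficiently small constant $\epsilon$ there is an $(\epsilon, \epsilon^{3/2})$-gap instance for Max-2-LIN$(\mathbb{Z}_2)$.)
   Context: The $d$-dimensional hypercube $Q_d = (V_d, E_d)$ has vertex set $V_d = \{0,1\}^d$, and two vertices are joined by an edge iff they differ in exactly one coordinate. A Max-2-LIN$(\mathbb{Z}_2)$ instance on $Q_d$ is a function $I : E_d \to \{0,1\}$; edges with $I(e)=0$ are equality edges (set $E^+$) and edges with $I(e)=1$ are inequality edges (set $E^-$). An assignment $\sigma : V_d \to \{0,1\}$ satisfies an equality edge $\{u,v\}$ if $\sigma(u)=\sigma(v)$ and an inequality edge if $\sigma(u)\neq\sigma(v)$. The combinatorial value of $I$ is the minimum, over all assignments $\sigma$, of the fraction of edges of $E_d$ not satisfied by $\sigma$. The Goemans--Williamson (GW) SDP value of $I$ is the minimum, over all dimensions $N$ and all maps $x : V_d \to \mathbb{R}^N$ with $\|x_u\|^2 = 1$ for all $u$, of $\frac{1}{4|E_d|}\Big(\sum_{\{u,v\}\in E^+}\|x_u - x_v\|^2 + \sum_{\{u,v\}\in E^-}\|x_u + x_v\|^2\Big)$. An infinite family $\mathcal F$ of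 such instances (on hypercubes of varying dimensions) is an $(\alpha,\beta)$-gap instance if the combinatorial value of every $I\in\mathcal F$ is $\Omega(\alpha)$ and its GW SDP value is $O(\beta)$. *)

theory Defs
  imports "HOL-Analysis.Analysis"
begin

type_synonym vertex = "nat \<Rightarrow> nat"

definition hc_verts :: "nat \<Rightarrow> vertex set" where
  "hc_verts d = {..<d} \<rightarrow>\<^sub>E {0, 1}"

definition hc_edges :: "nat \<Rightarrow> vertex set set" where
  "hc_edges d = {{u, v} | u v. u \<in> hc_verts d \<and> v \<in> hc_verts d \<and>
                               card {i \<in> {..<d}. u i \<noteq> v i} = 1}"

text \<open>
  Extensionality outside the edge set makes two instances on the same cube equal iff
  they agree on its edges, so that infinitely many instances really are infinitely many
  different ones, necessarily of unbounded dimension.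
\<close>

definition lin2_instances :: "nat \<Rightarrow> (vertex set \<Rightarrow> nat) set" where
  "lin2_instances d = hc_edges d \<rightarrow>\<^sub>E {0, 1}"

definition eq_edges :: "nat \<Rightarrow> (vertex set \<Rightarrow> nat) \<Rightarrow> vertex set set" where
  "eq_edges d I = {e \<in> hc_edges d. I e = 0}"

definition ineq_edges :: "nat \<Rightarrow> (vertex set \<Rightarrow> nat) \<Rightarrow> vertex set set" where
  "ineq_edges d I = {e \<in> hc_edges d. I e = 1}"

definition assignments :: "nat \<Rightarrow> (vertex \<Rightarrow> nat) set" where
  "assignments d = hc_verts d \<rightarrow>\<^sub>E {0, 1}"

definition satisfied_edges ::
    "nat \<Rightarrow> (vertex set \<Rightarrow> nat) \<Rightarrow> (vertex \<Rightarrow> nat) \<Rightarrow> vertex set set" where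
  "satisfied_edges d I \<sigma> =
     {e \<in> eq_edges d I. \<exists>u v. e = {u, v} \<and> \<sigma> u = \<sigma> v} \<union>
     {e \<in> ineq_edges d I. \<exists>u v. e = {u, v} \<and> \<sigma> u \<noteq> \<sigma> v}"

definition unsat_fraction ::
    "nat \<Rightarrow> (vertex set \<Rightarrow> nat) \<Rightarrow> (vertex \<Rightarrow> nat) \<Rightarrow> real" where
  "unsat_fraction d I \<sigma> =
     real (card (hc_edges d - satisfied_edges d I \<sigma>)) / real (card (hc_edges d))"

text \<open>On the edgeless cube \<open>d = 0\<close> the fraction is \<open>0 / 0 = 0\<close>, so the value below is \<open>0\<close>.\<close>

definition combinatorial_value :: "nat \<Rightarrow> (vertex set \<Rightarrow> nat) \<Rightarrow> real" where
  "combinatorial_value d I = Min (unsat_fraction d I ` assignments d)"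

text \<open>
  The value \<open>f u v\<close> at an unordered pair \<open>{u, v}\<close>; meaningful only for symmetric \<open>f\<close>
  (see \<open>on_edge_eq\<close>).
\<close>

definition on_edge :: "('a \<Rightarrow> 'a \<Rightarrow> real) \<Rightarrow> 'a set \<Rightarrow> real" where
  "on_edge f e = (THE r. \<exists>u v. e = {u, v} \<and> r = f u v)"

lemma on_edge_eq:
  assumes "\<And>u v. f u v = f v u"
  shows "on_edge f {u, v} = f u v"
  unfolding on_edge_def
  by (rule the_equality) (use assms in \<open>auto simp: doubleton_eq_iff\<close>)

text \<open>
  Since the dimension \<open>N\<close> is minimised over, a vector of \<open>\<real>\<^sup>N\<close> is represented by a function
  \<open>nat \<Rightarrow> real\<close> of which only the components below \<open>N\<close> matter; its Euclidean norm is
  \<open>L2_set\<close> over \<open>{..<N}\<close>.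
\<close>

definition gw_feasible :: "nat \<Rightarrow> nat \<Rightarrow> (vertex \<Rightarrow> nat \<Rightarrow> real) \<Rightarrow> bool" where
  "gw_feasible d N x \<longleftrightarrow> (\<forall>u \<in> hc_verts d. (L2_set (x u) {..<N})\<^sup>2 = 1)"

definition gw_objective ::
    "nat \<Rightarrow> (vertex set \<Rightarrow> nat) \<Rightarrow> nat \<Rightarrow> (vertex \<Rightarrow> nat \<Rightarrow> real) \<Rightarrow> real" where
  "gw_objective d I N x =
     1 / (4 * real (card (hc_edges d))) *
       ((\<Sum>e \<in> eq_edges d I. on_edge (\<lambda>u v. (L2_set (\<lambda>i. x u i - x v i) {..<N})\<^sup>2) e) +
        (\<Sum>e \<in> ineq_edges d I. on_edge (\<lambda>u v. (L2_set (\<lambda>i. x u i + x v i) {..<N})\<^sup>2) e))"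

definition gw_sdp_value :: "nat \<Rightarrow> (vertex set \<Rightarrow> nat) \<Rightarrow> real" where
  "gw_sdp_value d I = Inf {gw_objective d I N x | N x. gw_feasible d N x}"

lemma finite_hc_verts: "finite (hc_verts d)"
  by (auto simp: hc_verts_def intro!: finite_PiE)

lemma finite_hc_edges: "finite (hc_edges d)"
proof (rule finite_subset)
  show "hc_edges d \<subseteq> Pow (hc_verts d)"
    by (auto simp: hc_edges_def)
qed (simp add: finite_hc_verts)

lemma finite_lin2_instances: "finite (lin2_instances d)"
  by (auto simp: lin2_instances_def finite_hc_edges intro!: finite_PiE)

lemma finite_assignments: "finite (assignments d)"
  by (auto simp: assignments_def finite_hc_verts intro!: finite_PiE)

lemma assignments_nonempty: "assignments d \<noteq> {}"
  by (simp add: assignments_def PiE_eq_empty_iff)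

text \<open>
  The infimum in \<open>gw_sdp_value\<close> is over a nonempty set of nonnegative reals. It is a minimum:
  vectors indexed by the finitely many vertices already embed into \<open>\<real>\<^sup>N\<close> with
  \<open>N = card (hc_verts d)\<close>, where the feasible set is compact.
\<close>

lemma gw_feasible_exists: "\<exists>N x. gw_feasible d N x"
  by (rule exI[of _ 1], rule exI[of _ "\<lambda>_ _. 1"]) (simp add: gw_feasible_def L2_set_def)

lemma gw_objective_nonneg: "0 \<le> gw_objective d I N x"
proof -
  have "0 \<le> on_edge (\<lambda>u v. (L2_set (\<lambda>i. x u i - x v i) {..<N})\<^sup>2) e"
       "0 \<le> on_edge (\<lambda>u v. (L2_set (\<lambda>i. x u i + x v i) {..<N})\<^sup>2) e"
    if e: "e \<in> hc_edges d" for e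
  proof -
    obtain u v where uv: "e = {u, v}"
      using e by (auto simp: hc_edges_def)
    have "on_edge (\<lambda>u v. (L2_set (\<lambda>i. x u i - x v i) {..<N})\<^sup>2) {u, v}
            = (L2_set (\<lambda>i. x u i - x v i) {..<N})\<^sup>2"
      by (rule on_edge_eq) (simp add: L2_set_def power2_commute)
    moreover have "on_edge (\<lambda>u v. (L2_set (\<lambda>i. x u i + x v i) {..<N})\<^sup>2) {u, v}
            = (L2_set (\<lambda>i. x u i + x v i) {..<N})\<^sup>2"
      by (rule on_edge_eq) (simp add: add.commute)
    ultimately show
       "0 \<le> on_edge (\<lambda>u v. (L2_set (\<lambda>i. x u i - x v i) {..<N})\<^sup>2) e"
       "0 \<le> on_edge (\<lambda>u v. (L2_set (\<lambda>i. x u i + x v i) {..<N})\<^sup>2) e"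
      by (simp_all add: uv)
  qed
  then show ?thesis
    unfolding gw_objective_def
    by (intro mult_nonneg_nonneg add_nonneg_nonneg sum_nonneg)
       (auto simp: eq_edges_def ineq_edges_def)
qed

lemma gw_sdp_value_le:
  assumes "gw_feasible d N x"
  shows "gw_sdp_value d I \<le> gw_objective d I N x"
  unfolding gw_sdp_value_def
  by (rule cInf_lower)
     (use assms in \<open>auto intro!: bdd_belowI[of _ 0] gw_objective_nonneg\<close>)

end

theory Submission
  imports Defs "HOL-Combinatorics.Permutations"
begin

text \<open>
  Put a vortex lattice on the grid and pull it back to the cube. Split the \<open>2m\<close> coordinates into
  two halves, let \<open>(j, k)\<close> be the numbers of ones in the halves, and choose \<open>l\<close> of order \<open>1 / \<epsilon>\<close>,
  independent of \<open>m\<close>. Cut each axis of the grid into blocks of length \<open>l\<close>, and let the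
  inequality edges be those that cross a block boundary in the second direction while \<open>j\<close> lies in
  an odd block.

  Every \<open>l \<times> l\<close> square of the grid then has an odd boundary, so it contains a violated edge for
  each assignment. Lifting squares to the cube along random orderings of the coordinates makes each
  of the \<open>4l\<close> boundary edges uniform in its level, whence a violated fraction of order \<open>1 / l\<close>.

  For the relaxation take plane vectors that rotate by half the angle around each vortex: the sign
  picked up by a half turn is absorbed by the inequality edges, and an edge at distance \<open>r\<close> from the
  nearest vortex costs \<open>O(1 / r\<^sup>2)\<close>. With \<open>r\<^sup>2\<close> at least a product of a function of \<open>j\<close> and one of \<open>k\<close>,
  the average cost is \<open>O((log l / l)\<^sup>2)\<close>, which is below \<open>O(l powr (- 3 / 2))\<close>, since for \<open>m \<rightarrow> \<infinity>\<close> both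
  counts equidistribute modulo \<open>l\<close>.
\<close>

section \<open>Signed cubes in terms of oriented edges\<close>

definition indicator_vertex :: "nat \<Rightarrow> nat set \<Rightarrow> vertex" where
  "indicator_vertex d X = (\<lambda>i\<in>{..<d}. if i \<in> X then 1 else 0)"

text \<open>The pair \<open>(x, X)\<close> stands for the edge between the indicator vectors of \<open>X\<close> and \<open>X \<union> {x}\<close>.\<close>

definition oriented :: "nat \<Rightarrow> (nat \<times> nat set) set" where
  "oriented d = (SIGMA x:{..<d}. Pow ({..<d} - {x}))"

definition oedge :: "nat \<Rightarrow> nat \<times> nat set \<Rightarrow> vertex set" where
  "oedge d p = {indicator_vertex d (snd p), indicator_vertex d (insert (fst p) (snd p))}"

text \<open>Signs are prescribed on orientations, so that no choice of end has to be made for an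
  unordered pair; the restriction to \<open>hc_edges d\<close> gives the extensionality that
  \<open>lin2_instances\<close> demands.\<close>

definition signing :: "nat \<Rightarrow> (nat \<times> nat set \<Rightarrow> bool) \<Rightarrow> vertex set \<Rightarrow> nat" where
  "signing d neg = (\<lambda>e\<in>hc_edges d. if neg (the_inv_into (oriented d) (oedge d) e) then 1 else 0)"

lemma finite_oriented: "finite (oriented d)"
  by (auto simp: oriented_def)

lemma card_oriented: "card (oriented d) = d * 2 ^ (d - 1)"
  by (simp add: oriented_def card_Pow)

lemma indicator_vertex_in_hc_verts: "indicator_vertex d X \<in> hc_verts d"
  by (auto simp: indicator_vertex_def hc_verts_def)

lemma indicator_vertex_eq_iff:
  assumes "X \<subseteq> {..<d}" "Y \<subseteq> {..<d}"
  shows "indicator_vertex d X = indicator_vertex d Y \<longleftrightarrow> X = Y"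
proof
  assume eq: "indicator_vertex d X = indicator_vertex d Y"
  have "i \<in> X \<longleftrightarrow> i \<in> Y" if "i < d" for i
    using fun_cong[OF eq, of i] that by (auto simp: indicator_vertex_def split: if_splits)
  thus "X = Y" using assms by blast
qed simp

lemma indicator_vertex_support:
  assumes "u \<in> hc_verts d"
  shows "indicator_vertex d {i \<in> {..<d}. u i = 1} = u"
  using assms by (intro ext) (auto simp: indicator_vertex_def hc_verts_def PiE_iff extensional_def)

lemma support_indicator_vertex:
  assumes "X \<subseteq> {..<d}"
  shows "{i \<in> {..<d}. indicator_vertex d X i = 1} = X"
  using assms by (auto simp: indicator_vertex_def)

text \<open>An edge determines its end with fewer ones and the flipped coordinate, hence has exactly
  one orientation. Counts and sums over edges thus become counts and sums over pairs.\<close>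

lemma bij_betw_oedge: "bij_betw (oedge d) (oriented d) (hc_edges d)"
  unfolding bij_betw_def
proof
  show "inj_on (oedge d) (oriented d)"
  proof (rule inj_onI; clarify)
    fix x X y Y
    assume *: "(x, X) \<in> oriented d" "(y, Y) \<in> oriented d" "oedge d (x, X) = oedge d (y, Y)"
    hence sub: "insert x X \<subseteq> {..<d}" "insert y Y \<subseteq> {..<d}" "x \<notin> X" "y \<notin> Y"
      by (auto simp: oriented_def)
    hence "(X = Y \<and> insert x X = insert y Y) \<or> (X = insert y Y \<and> insert x X = Y)"
      using * indicator_vertex_eq_iff[of X d Y] indicator_vertex_eq_iff[of "insert x X" d "insert y Y"]
        indicator_vertex_eq_iff[of X d "insert y Y"] indicator_vertex_eq_iff[of "insert x X" d Y]
      by (auto simp: oedge_def doubleton_eq_iff)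
    thus "x = y \<and> X = Y" using sub by blast
  qed
next
  show "oedge d ` oriented d = hc_edges d"
  proof (intro equalityI subsetI)
    fix e assume "e \<in> oedge d ` oriented d"
    then obtain x X where p: "(x, X) \<in> oriented d" "e = oedge d (x, X)" by auto
    have "{i \<in> {..<d}. indicator_vertex d X i \<noteq> indicator_vertex d (insert x X) i} = {x}"
      using p by (auto simp: indicator_vertex_def oriented_def)
    thus "e \<in> hc_edges d"
      unfolding hc_edges_def mem_Collect_eq p
      by (intro exI[of _ "indicator_vertex d X"] exI[of _ "indicator_vertex d (insert x X)"])
         (simp add: oedge_def indicator_vertex_in_hc_verts)
  next
    fix e assume "e \<in> hc_edges d"
    then obtain u v where uv: "e = {u, v}" "u \<in> hc_verts d" "v \<in> hc_verts d"
      "card {i \<in> {..<d}. u i \<noteq> v i} = 1"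
      by (auto simp: hc_edges_def)
    then obtain x where x: "{i \<in> {..<d}. u i \<noteq> v i} = {x}" by (auto simp: card_1_singleton_iff)
    have x': "x < d" "u x \<noteq> v x" and same: "\<And>i. i < d \<Longrightarrow> i \<noteq> x \<Longrightarrow> u i = v i"
      using x by auto
    \<comment> \<open>Stated for the orientation with \<open>u x = 0\<close>; the other case swaps
      the two ends.\<close>
    have key: "{u, v} \<in> oedge d ` oriented d"
      if u: "u \<in> hc_verts d" and v: "v \<in> hc_verts d" and x: "x < d" "u x = 0" "v x = 1"
        and same: "\<And>i. i < d \<Longrightarrow> i \<noteq> x \<Longrightarrow> u i = v i" for u v :: vertex
    proof -
      let ?X = "{i \<in> {..<d}. u i = 1}"
      have "{i \<in> {..<d}. v i = 1} = insert x ?X"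
        using x same by force
      hence "{u, v} = oedge d (x, ?X)"
        using indicator_vertex_support[OF u] indicator_vertex_support[OF v] by (simp add: oedge_def)
      moreover have "(x, ?X) \<in> oriented d" using x by (auto simp: oriented_def)
      ultimately show ?thesis by blast
    qed
    have "u x \<in> {0, 1}" "v x \<in> {0, 1}"
      using uv x' by (auto simp: hc_verts_def PiE_iff)
    then consider "u x = 0" "v x = 1" | "v x = 0" "u x = 1"
      using x' by auto
    thus "e \<in> oedge d ` oriented d"
    proof cases
      case 1
      show ?thesis unfolding uv(1) by (rule key) (use 1 uv(2,3) x' same in auto)
    next
      case 2
      show ?thesis unfolding uv(1) insert_commute[of u v] by (rule key) (use 2 uv(2,3) x' same in auto)
    qed
  qed
qed

lemma card_hc_edges: "card (hc_edges d) = d * 2 ^ (d - 1)"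
  using bij_betw_same_card[OF bij_betw_oedge[of d]] by (simp add: card_oriented)

lemma signing_in_lin2_instances: "signing d neg \<in> lin2_instances d"
  by (auto simp: signing_def lin2_instances_def)

lemma oedge_in_hc_edges: "p \<in> oriented d \<Longrightarrow> oedge d p \<in> hc_edges d"
  using bij_betw_oedge[of d] by (auto simp: bij_betw_def)

lemma signing_oedge:
  assumes "p \<in> oriented d"
  shows "signing d neg (oedge d p) = (if neg p then 1 else 0)"
  using assms bij_betw_oedge[of d] oedge_in_hc_edges[OF assms]
  by (simp add: signing_def bij_betw_def the_inv_into_f_f)

lemma unsat_fraction_signing:
  "unsat_fraction d (signing d neg) \<sigma> =
     card {p \<in> oriented d. (\<sigma> (indicator_vertex d (snd p))
         \<noteq> \<sigma> (indicator_vertex d (insert (fst p) (snd p)))) \<noteq> neg p} / (d * 2 ^ (d - 1))"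
proof -
  let ?bad = "{p \<in> oriented d. (\<sigma> (indicator_vertex d (snd p))
         \<noteq> \<sigma> (indicator_vertex d (insert (fst p) (snd p)))) \<noteq> neg p}"
  have bad: "p \<in> ?bad \<longleftrightarrow> oedge d p \<notin> satisfied_edges d (signing d neg) \<sigma>"
    if p: "p \<in> oriented d" for p
  proof -
    have "(\<exists>u v. oedge d p = {u, v} \<and> \<sigma> u = \<sigma> v) \<longleftrightarrow>
          \<sigma> (indicator_vertex d (snd p)) = \<sigma> (indicator_vertex d (insert (fst p) (snd p)))"
      and "(\<exists>u v. oedge d p = {u, v} \<and> \<sigma> u \<noteq> \<sigma> v) \<longleftrightarrow>
          \<sigma> (indicator_vertex d (snd p)) \<noteq> \<sigma> (indicator_vertex d (insert (fst p) (snd p)))"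
      unfolding oedge_def doubleton_eq_iff by metis+
    thus ?thesis
      using p oedge_in_hc_edges[OF p]
      by (auto simp: satisfied_edges_def eq_edges_def ineq_edges_def signing_oedge)
  qed
  have "oedge d ` ?bad = hc_edges d - satisfied_edges d (signing d neg) \<sigma>"
  proof (intro equalityI subsetI)
    fix e assume "e \<in> oedge d ` ?bad"
    then obtain p where "p \<in> ?bad" "e = oedge d p" by blast
    thus "e \<in> hc_edges d - satisfied_edges d (signing d neg) \<sigma>"
      using bad[of p] oedge_in_hc_edges[of p d] by blast
  next
    fix e assume e: "e \<in> hc_edges d - satisfied_edges d (signing d neg) \<sigma>"
    then obtain p where "p \<in> oriented d" "e = oedge d p"
      using bij_betw_oedge[of d] unfolding bij_betw_def by blast
    thus "e \<in> oedge d ` ?bad" using bad[of p] e by blast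
  qed
  moreover have "inj_on (oedge d) ?bad"
    using bij_betw_oedge[of d] by (auto simp: bij_betw_def intro: inj_on_subset)
  ultimately have "card (hc_edges d - satisfied_edges d (signing d neg) \<sigma>) = card ?bad"
    using card_image[of "oedge d" ?bad] by simp
  thus ?thesis by (simp add: unsat_fraction_def card_hc_edges)
qed

text \<open>Unit complex numbers form a feasible point in dimension 2. The sign of an inequality
  edge is moved to one end, since |b + a| = |b - (- a)|.\<close>

lemma gw_sdp_value_signing_le:
  fixes y :: "nat set \<Rightarrow> complex"
  assumes unit: "\<And>X. norm (y X) = 1"
  shows "gw_sdp_value d (signing d neg) \<le> 1 / (4 * real (d * 2 ^ (d - 1))) *
    (\<Sum>p\<in>oriented d. (norm (y (insert (fst p) (snd p))
        - (if neg p then - y (snd p) else y (snd p))))\<^sup>2)"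
proof -
  define c where "c p = (norm (y (insert (fst p) (snd p))
        - (if neg p then - y (snd p) else y (snd p))))\<^sup>2" for p
  define z where "z u = y {i \<in> {..<d}. u i = 1}" for u :: vertex
  define x where "x u i = (if i = 0 then Re (z u) else Im (z u))" for u :: vertex and i :: nat
  have L2: "(L2_set f {..<2})\<^sup>2 = (f 0)\<^sup>2 + (f 1)\<^sup>2" for f :: "nat \<Rightarrow> real"
    by (simp add: L2_set_def lessThan_nat_numeral numeral_2_eq_2)
  have "gw_feasible d 2 x"
    unfolding gw_feasible_def L2 using unit by (simp add: x_def z_def flip: cmod_power2)
  hence "gw_sdp_value d (signing d neg) \<le> gw_objective d (signing d neg) 2 x"
    by (rule gw_sdp_value_le)
  also have "gw_objective d (signing d neg) 2 x
      = 1 / (4 * real (d * 2 ^ (d - 1))) * (\<Sum>p\<in>oriented d. c p)"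
  proof -
    let ?m = "\<lambda>e. on_edge (\<lambda>u v. (L2_set (\<lambda>i. x u i - x v i) {..<2})\<^sup>2) e"
    let ?p = "\<lambda>e. on_edge (\<lambda>u v. (L2_set (\<lambda>i. x u i + x v i) {..<2})\<^sup>2) e"
    let ?I = "signing d neg"
    have m: "?m {u, v} = (norm (z v - z u))\<^sup>2" for u v
      by (subst on_edge_eq) (auto simp: L2 x_def power2_commute norm_minus_commute cmod_power2)
    have p: "?p {u, v} = (norm (z v + z u))\<^sup>2" for u v
      by (subst on_edge_eq) (auto simp: L2 x_def add.commute cmod_power2)
    have zi: "z (indicator_vertex d X) = y X" if "X \<subseteq> {..<d}" for X
      unfolding z_def support_indicator_vertex[OF that] ..
    have "(\<Sum>e\<in>eq_edges d ?I. ?m e) + (\<Sum>e\<in>ineq_edges d ?I. ?p e)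
        = (\<Sum>e\<in>hc_edges d. if ?I e = 0 then ?m e else 0) + (\<Sum>e\<in>hc_edges d. if ?I e = 1 then ?p e else 0)"
      unfolding eq_edges_def ineq_edges_def
      by (simp add: sum.inter_filter[OF finite_hc_edges])
    also have "\<dots> = (\<Sum>e\<in>hc_edges d. (if ?I e = 0 then ?m e else 0) + (if ?I e = 1 then ?p e else 0))"
      by (rule sum.distrib[symmetric])
    also have "\<dots> = (\<Sum>q\<in>oriented d. c q)"
    proof (rule sum.reindex_bij_betw[OF bij_betw_oedge, symmetric, THEN trans], rule sum.cong[OF refl])
      fix q assume q: "q \<in> oriented d"
      hence "snd q \<subseteq> {..<d}" "insert (fst q) (snd q) \<subseteq> {..<d}" by (auto simp: oriented_def)
      thus "(if ?I (oedge d q) = 0 then ?m (oedge d q) else 0)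
          + (if ?I (oedge d q) = 1 then ?p (oedge d q) else 0) = c q"
        unfolding signing_oedge[OF q] by (simp add: oedge_def m p zi c_def)
    qed
    finally show ?thesis unfolding gw_objective_def card_hc_edges by simp
  qed
  finally show ?thesis unfolding c_def .
qed

section \<open>Binomial sums\<close>

text \<open>Shifting \<open>g\<close> by one amounts to weighting it with the differences
  \<open>D\<close> of neighbouring binomial coefficients. The row is unimodal, so \<open>D\<close>
  is positive only up to the middle, where its partial sum telescopes to the central
  coefficient.\<close>

lemma sum_binomial_shift_le:
  fixes g :: "nat \<Rightarrow> real"
  assumes g: "\<And>j. 0 \<le> g j" "\<And>j. g j \<le> 1"
  shows "(\<Sum>j\<le>n. real (n choose j) * g j)
       \<le> (\<Sum>j\<le>n. real (n choose j) * g (Suc j)) + real (n choose (n div 2))"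
proof -
  define D where "D j = real (n choose j) - (if j = 0 then 0 else real (n choose (j - 1)))" for j
  have tele: "(\<Sum>j\<le>k. D j) = real (n choose k)" for k
    by (induction k) (auto simp: D_def)
  have shift: "(\<Sum>j\<le>n. (if j = 0 then 0 else real (n choose (j - 1))) * g j)
      \<le> (\<Sum>j\<le>n. real (n choose j) * g (Suc j))"
  proof (cases n)
    case (Suc k)
    have "(\<Sum>j\<le>Suc k. (if j = 0 then 0 else real (n choose (j - 1))) * g j)
        = (\<Sum>j\<le>k. real (n choose j) * g (Suc j))"
      by (subst sum.atMost_Suc_shift) simp
    also have "\<dots> \<le> (\<Sum>j\<le>n. real (n choose j) * g (Suc j))"
      using g Suc by (intro sum_mono2) auto
    finally show ?thesis using Suc by simp
  qed (use g in auto)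
  have "D j * g j \<le> (if j \<le> n div 2 then D j else 0)" if "j \<le> n" for j
  proof (cases "j \<le> n div 2")
    case True
    have "(n choose (j - 1)) \<le> n choose j"
      using True by (intro binomial_mono) auto
    hence "0 \<le> D j" by (auto simp: D_def)
    thus ?thesis using True g[of j] by (simp add: mult_left_le)
  next
    case False
    have "n choose j \<le> (n choose (j - 1))"
      using False that by (intro binomial_antimono) auto
    hence "D j \<le> 0" using False by (auto simp: D_def)
    thus ?thesis using False g[of j] by (simp add: mult_nonpos_nonneg)
  qed
  hence "(\<Sum>j\<le>n. D j * g j) \<le> (\<Sum>j\<le>n. if j \<le> n div 2 then D j else 0)"
    by (intro sum_mono) auto
  also have "\<dots> = (\<Sum>j\<le>n div 2. D j)"
    by (intro sum.mono_neutral_cong_right) auto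
  also have "\<dots> = real (n choose (n div 2))" by (rule tele)
  finally show ?thesis
    using shift by (simp add: D_def left_diff_distrib sum_subtractf)
qed

lemma sum_periodic_shift:
  fixes g :: "nat \<Rightarrow> 'a :: ab_group_add"
  assumes "\<And>j. g (j + l) = g j"
  shows "(\<Sum>t<l. g (j + t)) = (\<Sum>t<l. g t)"
proof (induction j)
  case (Suc j)
  have "(\<Sum>t<l. g (Suc j + t)) = (\<Sum>t<l. g (j + t)) + g (j + l) - g j"
    using sum.lessThan_Suc_shift[of "\<lambda>t. g (j + t)" l] sum.lessThan_Suc[of "\<lambda>t. g (j + t)" l]
    by (simp add: algebra_simps)
  thus ?case using Suc assms by simp
qed simp

text \<open>Averaging over the shifts \<open>t < l\<close>: each costs at most \<open>l\<close>
  central coefficients, and the shifts of a periodic \<open>g\<close> add up to a constant. So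
  binomial weights are nearly uniform modulo \<open>l\<close> once the central coefficient is small
  against \<open>2 ^ n\<close>.\<close>

lemma sum_binomial_periodic_le:
  fixes g :: "nat \<Rightarrow> real"
  assumes g: "\<And>j. 0 \<le> g j" "\<And>j. g j \<le> 1" and per: "\<And>j. g (j + l) = g j" and "l > 0"
  shows "(\<Sum>j\<le>n. real (n choose j) * g j)
       \<le> 2 ^ n * ((\<Sum>t<l. g t) / l) + l * real (n choose (n div 2))"
proof -
  define M where "M = real (n choose (n div 2))"
  define S where "S t = (\<Sum>j\<le>n. real (n choose j) * g (j + t))" for t
  have step: "S 0 \<le> S t + t * M" for t
  proof (induction t)
    case (Suc t)
    have "S t \<le> S (Suc t) + M"
      using sum_binomial_shift_le[of "\<lambda>j. g (j + t)" n] g by (simp add: S_def M_def)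
    thus ?case using Suc by (simp add: algebra_simps)
  qed simp
  have "l * S 0 = (\<Sum>t<l. S 0)" by simp
  also have "\<dots> \<le> (\<Sum>t<l. S t + l * M)"
  proof (intro sum_mono)
    fix t assume "t \<in> {..<l}"
    hence "t * M \<le> l * M" by (intro mult_right_mono) (auto simp: M_def)
    thus "S 0 \<le> S t + l * M" using step[of t] by linarith
  qed
  also have "\<dots> = (\<Sum>t<l. S t) + l * (l * M)" by (simp add: sum.distrib)
  also have "(\<Sum>t<l. S t) = (\<Sum>j\<le>n. real (n choose j) * (\<Sum>t<l. g (j + t)))"
    unfolding S_def sum_distrib_left by (rule sum.swap)
  also have "\<dots> = (\<Sum>j\<le>n. real (n choose j)) * (\<Sum>t<l. g t)"
    using sum_periodic_shift[of g l] per by (simp add: sum_distrib_right)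
  also have "(\<Sum>j\<le>n. real (n choose j)) = 2 ^ n"
    using choose_row_sum[of n] by (metis of_nat_sum of_nat_power of_nat_numeral)
  finally show ?thesis
    using \<open>l > 0\<close> by (simp add: S_def M_def field_simps)
qed

section \<open>Size of central binomial coefficients, of upper tails and of harmonic sums\<close>

lemma central_binomial_square_le: "(real ((2 * n) choose n))\<^sup>2 * (2 * n + 1) \<le> 16 ^ n"
proof (induction n)
  case (Suc n)
  have "Suc n * (Suc (Suc (2 * n)) choose Suc n) = 2 * (Suc n * (Suc (2 * n) choose n))"
    using Suc_times_binomial_eq[of "Suc (2 * n)" n] by (simp add: mult_ac del: binomial_Suc_Suc)
  moreover have "Suc (2 * n) choose n = Suc (2 * n) choose Suc n"
    using binomial_symmetric[of n "Suc (2 * n)"] by (simp del: binomial_Suc_Suc)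
  moreover have "Suc n * (Suc (2 * n) choose Suc n) = Suc (2 * n) * ((2 * n) choose n)"
    using Suc_times_binomial_eq[of "2 * n" n] by (simp only: mult_ac)
  ultimately have "Suc n * ((2 * Suc n) choose Suc n) = 2 * (Suc (2 * n) * ((2 * n) choose n))"
    by (simp only: mult_Suc_right add_2_eq_Suc)
  from arg_cong[OF this, of real]
  have eq: "real (Suc n) * real ((2 * Suc n) choose Suc n) = 2 * (2 * n + 1) * real ((2 * n) choose n)"
    by (simp only: of_nat_mult) simp
  have "(real (Suc n))\<^sup>2 * ((real ((2 * Suc n) choose Suc n))\<^sup>2 * (2 * Suc n + 1))
      = (real (Suc n) * real ((2 * Suc n) choose Suc n))\<^sup>2 * (2 * Suc n + 1)"
    by (simp add: power_mult_distrib)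
  also have "\<dots> = ((real ((2 * n) choose n))\<^sup>2 * (2 * n + 1)) * (4 * (2 * real n + 1) * (2 * real n + 3))"
    unfolding eq by (simp add: power2_eq_square algebra_simps)
  also have "\<dots> \<le> (16::real) ^ n * (4 * (2 * real n + 1) * (2 * real n + 3))"
    using Suc by (intro mult_right_mono) auto
  \<comment> \<open>This amounts to (2n + 1)(2n + 3) <= 4(n + 1)^2.\<close>
  also have "\<dots> \<le> 16 ^ n * (16 * (real (Suc n))\<^sup>2)"
    by (intro mult_left_mono) (auto simp: power2_eq_square algebra_simps)
  finally have "(real (Suc n))\<^sup>2 * ((real ((2 * Suc n) choose Suc n))\<^sup>2 * (2 * Suc n + 1))
      \<le> (real (Suc n))\<^sup>2 * 16 ^ Suc n"
    by (simp add: mult_ac)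
  thus ?case by (subst (asm) mult_le_cancel_left_pos) auto
qed simp

lemma eventually_central_binomial_le:
  assumes "\<delta> > 0"
  shows "eventually (\<lambda>n. real ((2 * n) choose n) \<le> \<delta> * 4 ^ n) sequentially"
proof -
  obtain N :: nat where N: "1 / \<delta>\<^sup>2 < N"
    using reals_Archimedean2 by blast
  have "real ((2 * n) choose n) \<le> \<delta> * 4 ^ n" if "n \<ge> N" for n
  proof -
    have "1 / \<delta>\<^sup>2 \<le> 2 * n + 1" using N that by linarith
    hence "1 \<le> \<delta>\<^sup>2 * (2 * n + 1)" using assms by (simp add: field_simps)
    hence "(real ((2 * n) choose n))\<^sup>2 * 1 \<le> (real ((2 * n) choose n))\<^sup>2 * (\<delta>\<^sup>2 * (2 * n + 1))"
      by (intro mult_left_mono) auto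
    also have "\<dots> = \<delta>\<^sup>2 * ((real ((2 * n) choose n))\<^sup>2 * (2 * n + 1))" by simp
    also have "\<dots> \<le> \<delta>\<^sup>2 * 16 ^ n"
      by (intro mult_left_mono central_binomial_square_le) auto
    also have "\<dots> = (\<delta> * 4 ^ n)\<^sup>2"
      by (simp add: power_mult_distrib flip: power_mult) (simp add: mult.commute[of n] power_mult)
    finally have "(real ((2 * n) choose n))\<^sup>2 \<le> (\<delta> * 4 ^ n)\<^sup>2" by (simp only: mult_1_right)
    thus ?thesis by (rule power2_le_imp_le) (use assms in simp)
  qed
  thus ?thesis by (auto simp: eventually_sequentially)
qed

text \<open>By symmetry the levels from \<open>h\<close> on carry at least half of the row; the
  \<open>l\<close> levels cut off carry at most the central coefficient each.\<close>

lemma sum_binomial_upper_tail_ge: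
  "(\<Sum>i=h + l..2 * h. real ((2 * h) choose i)) \<ge> 4 ^ h / 2 - l * real ((2 * h) choose h)"
proof -
  let ?b = "\<lambda>i. real ((2 * h) choose i)"
  have "4 ^ h = (\<Sum>i\<le>2 * h. ?b i)"
    by (simp only: choose_row_sum flip: of_nat_sum) (simp add: power_mult)
  also have "\<dots> \<le> (\<Sum>i\<in>{..h} \<union> {h..2 * h}. ?b i)"
    by (intro sum_mono2) auto
  also have "\<dots> \<le> (\<Sum>i\<in>{..h}. ?b i) + (\<Sum>i=h..2 * h. ?b i)"
    using sum.union_inter[of "{..h}" "{h..2 * h}" ?b] sum_nonneg[of "{..h} \<inter> {h..2 * h}" ?b]
    by simp
  also have "(\<Sum>i\<in>{..h}. ?b i) = (\<Sum>i=h..2 * h. ?b i)"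
    by (rule sum.reindex_bij_witness[of _ "\<lambda>i. 2 * h - i" "\<lambda>i. 2 * h - i"])
       (auto simp: binomial_symmetric[symmetric])
  finally have "4 ^ h / 2 \<le> (\<Sum>i=h..2 * h. ?b i)" by simp
  also have "\<dots> \<le> (\<Sum>i\<in>{h..<h + l} \<union> {h + l..2 * h}. ?b i)"
    by (intro sum_mono2) auto
  also have "\<dots> = (\<Sum>i=h..<h + l. ?b i) + (\<Sum>i=h + l..2 * h. ?b i)"
    by (intro sum.union_disjoint) auto
  also have "(\<Sum>i=h..<h + l. ?b i) \<le> (\<Sum>i=h..<h + l. ?b h)"
    by (intro sum_mono) (use binomial_maximum'[of h] in auto)
  finally show ?thesis by simp
qed

text \<open>The sum is at most 1 + ln n, and ln n is four times the logarithm of n^(1/4). This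
  exponent is the one for which the squared average of the harmonic terms becomes n^(-3/2).\<close>

lemma sum_inverse_le_powr: "n > 0 \<Longrightarrow> (\<Sum>i<n. 1 / real (Suc i)) \<le> 4 * real n powr (1 / 4)"
proof -
  assume n: "n > 0"
  have "(\<Sum>i<Suc k. 1 / real (Suc i)) \<le> 1 + ln (real (Suc k))" for k
  proof (induction k)
    case (Suc k)
    have "ln (real (Suc k) / real (Suc (Suc k))) \<le> real (Suc k) / real (Suc (Suc k)) - 1"
      by (intro ln_le_minus_one) auto
    also have "\<dots> = - (1 / real (Suc (Suc k)))" by (simp add: field_simps)
    finally have "1 / real (Suc (Suc k)) \<le> ln (real (Suc (Suc k))) - ln (real (Suc k))"
      by (simp add: ln_div)
    thus ?case using Suc by simp
  qed simp
  from this[of "n - 1"] n have "(\<Sum>i<n. 1 / real (Suc i)) \<le> 1 + ln (real n)" by simp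
  also have "ln (real n) = 4 * ln (real n powr (1 / 4))" using n by (simp add: ln_powr)
  also have "\<dots> \<le> 4 * (real n powr (1 / 4) - 1)"
    using n by (intro mult_left_mono ln_le_minus_one) auto
  finally show ?thesis by simp
qed

section \<open>Random orderings of two blocks of coordinates\<close>

text \<open>All fibres over \<open>C\<close> have the same size, the inequality being available in
  both directions, so \<open>e\<close> carries the uniform distribution on \<open>G\<close> to the
  uniform one on \<open>C\<close>.\<close>

lemma card_fiber_preimage:
  assumes "finite G" "finite C" and e: "\<And>g. g \<in> G \<Longrightarrow> e g \<in> C"
    and fib: "\<And>c c'. c \<in> C \<Longrightarrow> c' \<in> C \<Longrightarrow> card {g \<in> G. e g = c} \<le> card {g \<in> G. e g = c'}"
  shows "card {g \<in> G. e g \<in> B} * card C = card G * card (B \<inter> C)"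
proof (cases "C = {}")
  case True
  thus ?thesis using e by auto
next
  case False
  then obtain c0 where c0: "c0 \<in> C" by auto
  define K where "K = card {g \<in> G. e g = c0}"
  have K: "card {g \<in> G. e g = c} = K" if "c \<in> C" for c
    using fib[OF that c0] fib[OF c0 that] by (simp add: K_def)
  have count: "card {g \<in> G. e g \<in> D} = card D * K" if "D \<subseteq> C" for D
  proof -
    have "finite D" using that assms finite_subset by blast
    have "card {g \<in> G. e g \<in> D} = card (\<Union>c\<in>D. {g \<in> G. e g = c})"
      by (rule arg_cong[of _ _ card]) auto
    also have "\<dots> = (\<Sum>c\<in>D. card {g \<in> G. e g = c})"
      using assms \<open>finite D\<close> by (intro card_UN_disjoint) auto
    also have "\<dots> = (\<Sum>c\<in>D. K)" using that K by (intro sum.cong) auto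
    finally show ?thesis by simp
  qed
  have "{g \<in> G. e g \<in> B} = {g \<in> G. e g \<in> B \<inter> C}" using e by auto
  moreover have "{g \<in> G. e g \<in> C} = G" using e by auto
  ultimately show ?thesis using count[of "B \<inter> C"] count[of C] by simp
qed

text \<open>The oriented edges of one level in the direction of the first block; those in the other
  direction are \<open>flips Q P k j\<close>.\<close>

definition flips :: "nat set \<Rightarrow> nat set \<Rightarrow> nat \<Rightarrow> nat \<Rightarrow> (nat \<times> nat set) set" where
  "flips P Q j k = {(x, X). x \<in> P \<and> X \<subseteq> P \<union> Q - {x} \<and> card (X \<inter> P) = j \<and> card (X \<inter> Q) = k}"

text \<open>The orderings of the two blocks of coordinates, over which squares of the grid are
  averaged.\<close>

definition block_perms :: "nat set \<Rightarrow> nat set \<Rightarrow> (nat \<Rightarrow> nat) set" where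
  "block_perms P Q = {\<pi>. \<pi> permutes P \<union> Q \<and> \<pi> ` P = P \<and> \<pi> ` Q = Q}"

lemma block_perms_commute: "block_perms P Q = block_perms Q P"
  by (auto simp: block_perms_def Un_commute)

lemma finite_block_perms: "finite P \<Longrightarrow> finite Q \<Longrightarrow> finite (block_perms P Q)"
  by (rule finite_subset[of _ "{\<pi>. \<pi> permutes P \<union> Q}"]) (auto simp: block_perms_def finite_permutations)

lemma id_in_block_perms: "id \<in> block_perms P Q"
  by (auto simp: block_perms_def permutes_id)

lemma block_perms_inj: "\<pi> \<in> block_perms P Q \<Longrightarrow> inj \<pi>"
  by (auto simp: block_perms_def permutes_inj)

lemma block_perms_comp:
  assumes "\<tau> \<in> block_perms P Q" "\<pi> \<in> block_perms P Q"
  shows "\<tau> \<circ> \<pi> \<in> block_perms P Q"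
proof -
  have "(\<tau> \<circ> \<pi>) ` S = \<tau> ` \<pi> ` S" for S
    by (rule image_comp[symmetric])
  thus ?thesis
    using assms by (simp only: block_perms_def mem_Collect_eq permutes_compose)
qed

lemma flips_subset: "flips P Q j k \<subseteq> P \<times> Pow (P \<union> Q)"
  by (auto simp: flips_def)

lemma finite_flips: "finite P \<Longrightarrow> finite Q \<Longrightarrow> finite (flips P Q j k)"
  by (rule finite_subset[OF flips_subset]) auto

lemma block_perms_flips:
  assumes \<pi>: "\<pi> \<in> block_perms P Q" and p: "(x, X) \<in> flips P Q j k"
  shows "(\<pi> x, \<pi> ` X) \<in> flips P Q j k"
proof -
  have inj: "inj \<pi>" and im: "\<pi> ` P = P" "\<pi> ` Q = Q"
    using \<pi> block_perms_inj by (auto simp: block_perms_def)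
  have "\<pi> ` (P \<union> Q) = P \<union> Q" using im by (simp add: image_Un)
  hence "\<pi> ` X \<subseteq> P \<union> Q" using p by (auto simp: flips_def)
  moreover have "\<pi> ` X \<inter> P = \<pi> ` (X \<inter> P)" "\<pi> ` X \<inter> Q = \<pi> ` (X \<inter> Q)"
    using im inj by (metis image_Int)+
  moreover have "\<pi> x \<in> P" "\<pi> x \<notin> \<pi> ` X"
    using p im inj by (auto simp: flips_def inj_image_mem_iff)
  moreover have "card (\<pi> ` S) = card S" for S
    using inj by (intro card_image inj_on_subset[OF inj]) auto
  ultimately show ?thesis
    using p by (simp add: flips_def subset_Diff_insert)
qed

text \<open>The colour of a coordinate records all that an edge says about it. Since the multiset of
  colours depends only on the level, any two edges of a level are related by a colour preserving
  permutation.\<close>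

lemma flips_color_mset:
  assumes fin: "finite P" "finite Q" and disj: "P \<inter> Q = {}" and p: "(x, X) \<in> flips P Q j k"
  shows "image_mset (\<lambda>i. (i \<in> P, i \<in> X, i = x)) (mset_set (P \<union> Q)) =
     replicate_mset j (True, True, False) + replicate_mset 1 (True, False, True)
     + replicate_mset (card P - Suc j) (True, False, False)
     + replicate_mset k (False, True, False) + replicate_mset (card Q - k) (False, False, False)"
proof -
  have x: "x \<in> P" "x \<notin> X" "X \<subseteq> P \<union> Q" and c: "card (X \<inter> P) = j" "card (X \<inter> Q) = k"
    using p by (auto simp: flips_def)
  let ?c = "\<lambda>i. (i \<in> P, i \<in> X, i = x)"
  have const: "image_mset ?c (mset_set S) = replicate_mset (card S) a"
    if "\<And>i. i \<in> S \<Longrightarrow> ?c i = a" "finite S" for S a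
  proof -
    have "image_mset ?c (mset_set S) = image_mset (\<lambda>_. a) (mset_set S)"
      using that by (intro image_mset_cong) auto
    thus ?thesis by (simp add: image_mset_const_eq)
  qed
  have split: "P \<union> Q = (X \<inter> P) \<union> ({x} \<union> ((P - insert x (X \<inter> P)) \<union> ((X \<inter> Q) \<union> (Q - X \<inter> Q))))"
    using x by auto
  have "card (P - insert x (X \<inter> P)) = card P - Suc j"
    using fin x c by (subst card_Diff_subset) (auto simp: card_insert_if)
  moreover have "card (Q - X \<inter> Q) = card Q - k"
    using fin c by (subst card_Diff_subset) auto
  moreover have "mset_set (P \<union> Q) = mset_set (X \<inter> P) + (mset_set {x}
      + (mset_set (P - insert x (X \<inter> P)) + (mset_set (X \<inter> Q) + mset_set (Q - X \<inter> Q))))"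
  proof -
    let ?R4 = "(X \<inter> Q) \<union> (Q - X \<inter> Q)"
    let ?R3 = "(P - insert x (X \<inter> P)) \<union> ?R4"
    have "mset_set ?R4 = mset_set (X \<inter> Q) + mset_set (Q - X \<inter> Q)"
      by (rule mset_set_Union) (use fin in auto)
    moreover have "mset_set ?R3 = mset_set (P - insert x (X \<inter> P)) + mset_set ?R4"
      by (rule mset_set_Union) (use fin disj in auto)
    moreover have "mset_set ({x} \<union> ?R3) = mset_set {x} + mset_set ?R3"
      by (rule mset_set_Union) (use fin disj x in auto)
    moreover have "mset_set ((X \<inter> P) \<union> ({x} \<union> ?R3)) = mset_set (X \<inter> P) + mset_set ({x} \<union> ?R3)"
      by (rule mset_set_Union) (use fin disj x in auto)
    ultimately show ?thesis unfolding split[symmetric] by (simp only:)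
  qed
  moreover have "image_mset ?c (mset_set (X \<inter> P)) = replicate_mset (card (X \<inter> P)) (True, True, False)"
    using x fin by (intro const) auto
  moreover have "image_mset ?c (mset_set {x}) = replicate_mset (card {x}) (True, False, True)"
    using x fin by (intro const) auto
  moreover have "image_mset ?c (mset_set (P - insert x (X \<inter> P)))
      = replicate_mset (card (P - insert x (X \<inter> P))) (True, False, False)"
    using x fin by (intro const) auto
  moreover have "image_mset ?c (mset_set (X \<inter> Q)) = replicate_mset (card (X \<inter> Q)) (False, True, False)"
    using x fin disj by (intro const) auto
  moreover have "image_mset ?c (mset_set (Q - X \<inter> Q)) = replicate_mset (card (Q - X \<inter> Q)) (False, False, False)"
    using x fin disj by (intro const) auto
  ultimately show ?thesis using c by (simp add: add_ac del: replicate_mset_Suc)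
qed

text \<open>The first colour component keeps the blocks, the second carries \<open>X\<close> to
  \<open>X'\<close>, the third \<open>x\<close> to \<open>x'\<close>.\<close>

lemma block_perms_transitive:
  assumes fin: "finite P" "finite Q" and disj: "P \<inter> Q = {}"
    and p: "(x, X) \<in> flips P Q j k" "(x', X') \<in> flips P Q j k"
  obtains \<tau> where "\<tau> \<in> block_perms P Q" "\<tau> x = x'" "\<tau> ` X = X'"
proof -
  have "image_mset (\<lambda>i. (i \<in> P, i \<in> X, i = x)) (mset_set (P \<union> Q))
      = image_mset (\<lambda>i. (i \<in> P, i \<in> X', i = x')) (mset_set (P \<union> Q))"
    using flips_color_mset[OF fin disj p(1)] flips_color_mset[OF fin disj p(2)] by simp
  then obtain \<tau> where \<tau>: "\<tau> permutes P \<union> Q"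
    and col: "\<And>i. i \<in> P \<union> Q \<Longrightarrow> (i \<in> P, i \<in> X, i = x) = (\<tau> i \<in> P, \<tau> i \<in> X', \<tau> i = x')"
    using image_mset_eq_implies_permutes[of "P \<union> Q"] fin by (metis (no_types, lifting) finite_Un)
  have onto: "\<exists>i\<in>P \<union> Q. \<tau> i = b" if "b \<in> P \<union> Q" for b
    using permutes_image[OF \<tau>] that by (metis imageE)
  have P: "\<tau> ` P = P"
  proof (intro equalityI subsetI)
    fix b assume b: "b \<in> P"
    then obtain i where "i \<in> P \<union> Q" "\<tau> i = b" using onto by blast
    thus "b \<in> \<tau> ` P" using col[of i] b by auto
  qed (use col in auto)
  have "\<tau> ` (P \<union> Q - P) = P \<union> Q - P"
    using image_set_diff[OF permutes_inj[OF \<tau>], of "P \<union> Q" P] P permutes_image[OF \<tau>] by simp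
  moreover have "P \<union> Q - P = Q" using disj by blast
  ultimately have "\<tau> ` Q = Q" by simp
  moreover have "\<tau> x = x'" using col[of x] p by (auto simp: flips_def)
  moreover have "\<tau> ` X = X'"
  proof (intro equalityI subsetI)
    fix b assume "b \<in> \<tau> ` X"
    thus "b \<in> X'" using col p by (auto simp: flips_def)
  next
    fix b assume b: "b \<in> X'"
    hence "b \<in> P \<union> Q" using p by (auto simp: flips_def)
    then obtain i where "i \<in> P \<union> Q" "\<tau> i = b" using onto by blast
    thus "b \<in> \<tau> ` X" using col[of i] b by auto
  qed
  ultimately show ?thesis using that[of \<tau>] \<tau> P by (auto simp: block_perms_def)
qed

text \<open>The image of a fixed edge under a random ordering is uniform in its level: by
  transitivity, composition with a suitable \<open>\<tau>\<close> injects the fibre over one edge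
  into that over any other.\<close>

lemma card_block_perms_hit:
  assumes fin: "finite P" "finite Q" and disj: "P \<inter> Q = {}" and p: "(x, X) \<in> flips P Q j k"
  shows "card {\<pi> \<in> block_perms P Q. (\<pi> x, \<pi> ` X) \<in> B} * card (flips P Q j k)
       = card (block_perms P Q) * card (B \<inter> flips P Q j k)"
proof (rule card_fiber_preimage)
  show "finite (block_perms P Q)" "finite (flips P Q j k)"
    using fin by (auto simp: finite_block_perms finite_flips)
  show "(\<pi> x, \<pi> ` X) \<in> flips P Q j k" if "\<pi> \<in> block_perms P Q" for \<pi>
    using block_perms_flips[OF that p] .
  fix c c' assume c: "c \<in> flips P Q j k" "c' \<in> flips P Q j k"
  obtain y Y y' Y' where y: "c = (y, Y)" "c' = (y', Y')" by fastforce
  obtain \<tau> where \<tau>: "\<tau> \<in> block_perms P Q" "\<tau> y = y'" "\<tau> ` Y = Y'"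
    using block_perms_transitive[OF fin disj] c y by metis
  show "card {\<pi> \<in> block_perms P Q. (\<pi> x, \<pi> ` X) = c} \<le> card {\<pi> \<in> block_perms P Q. (\<pi> x, \<pi> ` X) = c'}"
  proof (rule card_inj_on_le[of "\<lambda>\<pi>. \<tau> \<circ> \<pi>"])
    show "inj_on (\<lambda>\<pi>. \<tau> \<circ> \<pi>) {\<pi> \<in> block_perms P Q. (\<pi> x, \<pi> ` X) = c}"
      using block_perms_inj[OF \<tau>(1)] by (intro inj_onI) (simp add: fun_eq_iff inj_eq)
    show "(\<lambda>\<pi>. \<tau> \<circ> \<pi>) ` {\<pi> \<in> block_perms P Q. (\<pi> x, \<pi> ` X) = c}
        \<subseteq> {\<pi> \<in> block_perms P Q. (\<pi> x, \<pi> ` X) = c'}"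
      using \<tau> y by (auto intro: block_perms_comp)
    show "finite {\<pi> \<in> block_perms P Q. (\<pi> x, \<pi> ` X) = c'}"
      using finite_block_perms[OF fin] by auto
  qed
qed

section \<open>Counting subsets by their sizes in two blocks\<close>

lemma bij_betw_subsets_Un:
  assumes "P \<inter> Q = {}"
  shows "bij_betw (\<lambda>X. (X \<inter> P, X \<inter> Q)) (Pow (P \<union> Q)) (Pow P \<times> Pow Q)"
  by (rule bij_betw_byWitness[where f' = "\<lambda>(S, T). S \<union> T"]) (use assms in auto)

lemma card_subsets_Un:
  assumes fin: "finite P" "finite Q" and disj: "P \<inter> Q = {}"
  shows "card {X. X \<subseteq> P \<union> Q \<and> card (X \<inter> P) = j \<and> card (X \<inter> Q) = k}
       = (card P choose j) * (card Q choose k)"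
proof -
  have "bij_betw (\<lambda>X. (X \<inter> P, X \<inter> Q)) {X. X \<subseteq> P \<union> Q \<and> card (X \<inter> P) = j \<and> card (X \<inter> Q) = k}
      ({S. S \<subseteq> P \<and> card S = j} \<times> {T. T \<subseteq> Q \<and> card T = k})"
  proof (rule bij_betw_byWitness[where f' = "\<lambda>(S, T). S \<union> T"])
    have "(S \<union> T) \<inter> P = S" "(S \<union> T) \<inter> Q = T" if "S \<subseteq> P" "T \<subseteq> Q" for S T
      using that disj by auto
    thus "(\<lambda>(S, T). S \<union> T) ` ({S. S \<subseteq> P \<and> card S = j} \<times> {T. T \<subseteq> Q \<and> card T = k})
        \<subseteq> {X. X \<subseteq> P \<union> Q \<and> card (X \<inter> P) = j \<and> card (X \<inter> Q) = k}"
      by auto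
  qed (use disj in auto)
  from bij_betw_same_card[OF this] show ?thesis
    using n_subsets[of P j] n_subsets[of Q k] fin by (simp add: card_cartesian_product)
qed

lemma card_flips:
  assumes fin: "finite P" "finite Q" and disj: "P \<inter> Q = {}"
  shows "card (flips P Q j k) = card P * ((card P - 1) choose j) * (card Q choose k)"
proof -
  have "X \<inter> P = X \<inter> (P - {x})" if "x \<in> P" "X \<subseteq> P \<union> Q - {x}" for x X
    using that by auto
  moreover have "P \<union> Q - {x} = (P - {x}) \<union> Q" if "x \<in> P" for x
    using that disj by auto
  ultimately have "flips P Q j k = (SIGMA x:P. {X. X \<subseteq> (P - {x}) \<union> Q \<and> card (X \<inter> (P - {x})) = j \<and> card (X \<inter> Q) = k})"
    by (auto simp: flips_def)
  moreover have "card {X. X \<subseteq> (P - {x}) \<union> Q \<and> card (X \<inter> (P - {x})) = j \<and> card (X \<inter> Q) = k}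
      = ((card P - 1) choose j) * (card Q choose k)" if "x \<in> P" for x
    using that fin disj by (subst card_subsets_Un) auto
  ultimately show ?thesis
    using fin by (simp add: card_SigmaI)
qed

lemma sum_Pow_card:
  assumes "finite P"
  shows "(\<Sum>S\<in>Pow P. F (card S)) = (\<Sum>j\<le>card P. real (card P choose j) * F j)"
proof -
  have "(\<Sum>S\<in>Pow P. F (card S)) = (\<Sum>j\<le>card P. \<Sum>S\<in>{S \<in> Pow P. card S = j}. F (card S))"
    by (rule sum.group[symmetric]) (use assms card_mono in auto)
  also have "\<dots> = (\<Sum>j\<le>card P. real (card P choose j) * F j)"
    using n_subsets[OF assms] by (intro sum.cong) auto
  finally show ?thesis .
qed

lemma sum_Pow_Un_card:
  assumes fin: "finite P" "finite Q" and disj: "P \<inter> Q = {}"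
  shows "(\<Sum>X\<in>Pow (P \<union> Q). F (card (X \<inter> P)) * G (card (X \<inter> Q)))
     = (\<Sum>j\<le>card P. real (card P choose j) * F j) * (\<Sum>k\<le>card Q. real (card Q choose k) * G k)"
proof -
  have "(\<Sum>X\<in>Pow (P \<union> Q). F (card (X \<inter> P)) * G (card (X \<inter> Q)))
      = (\<Sum>(S, T)\<in>Pow P \<times> Pow Q. F (card S) * G (card T))"
    using sum.reindex_bij_betw[OF bij_betw_subsets_Un[OF disj], of "\<lambda>(S, T). F (card S) * G (card T)"]
    by simp
  also have "\<dots> = (\<Sum>S\<in>Pow P. F (card S)) * (\<Sum>T\<in>Pow Q. G (card T))"
    by (simp add: sum_product sum.cartesian_product)
  finally show ?thesis using fin by (simp add: sum_Pow_card)
qed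

section \<open>The vortex lattice and its relaxation\<close>

definition even_block :: "nat \<Rightarrow> nat \<Rightarrow> bool" where
  "even_block l j \<longleftrightarrow> even (j div l)"

text \<open>One plus the distance to the nearer end of the block; the summand 1 keeps it
  positive.\<close>

definition height :: "nat \<Rightarrow> nat \<Rightarrow> real" where
  "height l j = 1 + real (min (j mod l) (l - 1 - j mod l))"

text \<open>
  With \<open>a = \<plusminus>height l j\<close> and \<open>b = \<plusminus>height l k\<close>, signed by the parity of the block, this is a
  piecewise linear substitute for a square root of \<open>a + \<i> b\<close>: its argument runs from \<open>0\<close> to
  \<open>\<plusminus>pi / 2\<close> while that of \<open>a + \<i> b\<close> runs from \<open>0\<close> to \<open>\<plusminus>pi\<close>, with a change of sign across \<open>a < 0\<close>,
  \<open>b = 0\<close>.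
\<close>

definition spinor :: "nat \<Rightarrow> nat \<Rightarrow> nat \<Rightarrow> complex" where
  "spinor l j k = Complex ((if even_block l j then height l j else 0) + height l k)
     ((if even_block l k then 1 else - 1) * ((if even_block l j then 0 else height l j) + height l k))"

lemma height_ge_1: "height l j \<ge> 1"
  by (simp add: height_def)

lemma height_periodic: "height l (j + l) = height l j"
  by (simp add: height_def)

lemma even_block_add: "l > 0 \<Longrightarrow> even_block l (j + l) \<longleftrightarrow> \<not> even_block l j"
  by (simp add: even_block_def)

text \<open>A crossing leads from residue \<open>l - 1\<close> to residue 0, both ends of a block.
  Elsewhere the residue grows by one, and a minimum of two terms that each move by at most one moves
  by at most one.\<close>

lemma height_step:
  assumes "l > 0"
  shows "if even_block l (Suc j) = even_block l j then \<bar>height l (Suc j) - height l j\<bar> \<le> 1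
         else height l j = 1 \<and> height l (Suc j) = 1"
proof (cases "Suc (j mod l) = l")
  case True
  hence "Suc j mod l = 0" "j mod l = l - 1" by (auto simp: mod_Suc)
  thus ?thesis by (auto simp: height_def even_block_def div_Suc)
next
  case False
  hence "Suc j mod l = Suc (j mod l)" by (auto simp: mod_Suc)
  moreover have "Suc (j mod l) < l" using False assms mod_less_divisor[of l j] by linarith
  ultimately show ?thesis by (auto simp: height_def even_block_def div_Suc min_def)
qed

text \<open>The reciprocal of a minimum is at most the sum of the reciprocals; each end of the block
  contributes one harmonic sum.\<close>

lemma sum_inverse_height_le: "(\<Sum>t<l. 1 / height l t) \<le> 2 * (\<Sum>i<l. 1 / real (Suc i))"
proof -
  have "(\<Sum>t<l. 1 / height l t) \<le> (\<Sum>t<l. 1 / real (Suc t) + 1 / real (Suc (l - Suc t)))"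
    by (intro sum_mono) (auto simp: height_def min_def)
  also have "\<dots> = 2 * (\<Sum>i<l. 1 / real (Suc i))"
    by (simp only: sum.distrib sum.nat_diff_reindex[of "\<lambda>i. 1 / real (Suc i)" l])
  finally show ?thesis .
qed

lemma spinor_step_fst:
  assumes "l > 0"
  shows "(norm (spinor l (Suc j) k - spinor l j k))\<^sup>2 \<le> 4"
proof (cases "even_block l (Suc j) = even_block l j")
  case True
  hence "(height l (Suc j) - height l j)\<^sup>2 \<le> 1"
    using height_step[OF assms, of j] by (simp add: abs_square_le_1)
  thus ?thesis
    using True by (cases "even_block l j"; cases "even_block l k") (simp_all add: spinor_def cmod_power2 power2_commute)
next
  case False
  hence "height l j = 1" "height l (Suc j) = 1" using height_step[OF assms, of j] by auto
  thus ?thesis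
    using False by (cases "even_block l j"; cases "even_block l k") (simp_all add: spinor_def cmod_power2)
qed

text \<open>A crossing conjugates the spinor. For even \<open>j\<close> the imaginary part is
  \<plusminus>1 there, so this moves it by 2. For odd \<open>j\<close> the real part is 1, so the
  conjugate differs by 2 from the negated spinor, which is what an inequality edge compares.\<close>

lemma spinor_step_snd:
  assumes "l > 0"
  shows "(norm (spinor l j (Suc k) -
           (if \<not> even_block l j \<and> even_block l k \<noteq> even_block l (Suc k) then - spinor l j k else spinor l j k)))\<^sup>2 \<le> 4"
proof (cases "even_block l (Suc k) = even_block l k")
  case True
  hence "(height l (Suc k) - height l k)\<^sup>2 \<le> 1"
    using height_step[OF assms, of k] by (simp add: abs_square_le_1)
  thus ?thesis
    using True by (cases "even_block l j"; cases "even_block l k") (simp_all add: spinor_def cmod_power2 power2_commute)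
next
  case False
  hence "height l k = 1" "height l (Suc k) = 1" using height_step[OF assms, of k] by auto
  thus ?thesis
    using False by (cases "even_block l j"; cases "even_block l k") (simp_all add: spinor_def cmod_power2)
qed

text \<open>For every parity one component is, up to sign, the sum of the two heights. The bound is
  a product so that the edge costs factor into functions of \<open>j\<close> and of
  \<open>k\<close>.\<close>

lemma norm_spinor_ge: "(norm (spinor l j k))\<^sup>2 \<ge> 2 * height l j * height l k"
proof -
  have "height l j \<ge> 0" "height l k \<ge> 0" using height_ge_1[of l j] height_ge_1[of l k] by auto
  hence "height l j * height l k \<ge> 0" by simp
  thus ?thesis
    by (simp add: spinor_def cmod_power2 power_mult_distrib) (simp add: power2_eq_square algebra_simps)
qed

section \<open>Normalisation of the spinor and the cost of the relaxation\<close>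

lemma norm_sgn_diff_le:
  fixes z w :: "'a :: real_normed_vector"
  assumes "z \<noteq> 0"
  shows "norm (sgn w - sgn z) \<le> 2 * norm (w - z) / norm z"
proof (cases "w = 0")
  case True
  thus ?thesis using assms by (simp add: norm_sgn)
next
  case False
  \<comment> \<open>The displacement scaled by \<open>norm z\<close>, plus the correction for the
    change of length; each is at most \<open>norm (w - z) / norm z\<close>.\<close>
  have "sgn w - sgn z = (w - z) /\<^sub>R norm z + (inverse (norm w) - inverse (norm z)) *\<^sub>R w"
    by (simp add: sgn_div_norm algebra_simps)
  also have "norm \<dots> \<le> norm ((w - z) /\<^sub>R norm z) + norm ((inverse (norm w) - inverse (norm z)) *\<^sub>R w)"
    by (rule norm_triangle_ineq)
  also have "norm ((w - z) /\<^sub>R norm z) = norm (w - z) / norm z"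
    by (simp only: norm_scaleR) (simp add: divide_inverse mult.commute)
  also have "norm ((inverse (norm w) - inverse (norm z)) *\<^sub>R w) = \<bar>norm w - norm z\<bar> / norm z"
  proof -
    have "(inverse (norm w) - inverse (norm z)) * norm w = - (norm w - norm z) / norm z"
      using assms False by (simp add: field_simps)
    hence "\<bar>(inverse (norm w) - inverse (norm z)) * norm w\<bar> = \<bar>norm w - norm z\<bar> / norm z"
      by (simp add: abs_minus_commute)
    thus ?thesis by (simp add: abs_mult)
  qed
  also have "\<bar>norm w - norm z\<bar> / norm z \<le> norm (w - z) / norm z"
    by (intro divide_right_mono norm_triangle_ineq3) auto
  finally show ?thesis by simp
qed

text \<open>A step of length at most 2 from a vector of squared norm at least 2ab changes the
  direction by at most 4 / sqrt(2ab), hence the constant 8.\<close>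

lemma sgn_spinor_step_le:
  assumes "(norm (w - (if b then - spinor l j k else spinor l j k)))\<^sup>2 \<le> 4"
  shows "(norm (sgn w - (if b then - sgn (spinor l j k) else sgn (spinor l j k))))\<^sup>2
         \<le> 8 * (1 / height l j * (1 / height l k))"
proof -
  let ?z = "if b then - spinor l j k else spinor l j k"
  have h: "height l j > 0" "height l k > 0"
    using height_ge_1[of l j] height_ge_1[of l k] by auto
  have nz: "(norm ?z)\<^sup>2 \<ge> 2 * height l j * height l k" using norm_spinor_ge by simp
  hence pos: "(norm ?z)\<^sup>2 > 0" using h by (smt (verit) mult_pos_pos)
  hence z: "?z \<noteq> 0" by auto
  have "(norm (sgn w - sgn ?z))\<^sup>2 \<le> (2 * norm (w - ?z) / norm ?z)\<^sup>2"
    using norm_sgn_diff_le[OF z, of w] by (intro power_mono) auto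
  also have "\<dots> = 4 * (norm (w - ?z))\<^sup>2 / (norm ?z)\<^sup>2"
    by (simp add: power_mult_distrib power_divide)
  also have "\<dots> \<le> 4 * 4 / (2 * height l j * height l k)"
    using assms nz h by (intro frac_le) auto
  also have "\<dots> = 8 * (1 / height l j * (1 / height l k))" by simp
  also have "sgn ?z = (if b then - sgn (spinor l j k) else sgn (spinor l j k))"
    by (simp add: sgn_minus)
  finally show ?thesis .
qed

definition vortex_neg :: "nat \<Rightarrow> nat \<Rightarrow> nat \<times> nat set \<Rightarrow> bool" where
  "vortex_neg l m p \<longleftrightarrow> m \<le> fst p \<and> \<not> even_block l (card (snd p \<inter> {..<m})) \<and>
     even_block l (card (snd p \<inter> {m..<2 * m})) \<noteq> even_block l (Suc (card (snd p \<inter> {m..<2 * m})))"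

text \<open>The feasible point is the normalised spinor at the two counts. The cost bound is a
  function of \<open>j\<close> times the same function of \<open>k\<close>, so the sum over both
  halves is a square.\<close>

lemma gw_sdp_value_vortex_le:
  assumes "l > 0" "m > 0"
  shows "gw_sdp_value (2 * m) (signing (2 * m) (vortex_neg l m))
     \<le> 4 * ((\<Sum>j\<le>m. real (m choose j) * (1 / height l j)) / 2 ^ m)\<^sup>2"
proof -
  define S where "S = (\<Sum>j\<le>m. real (m choose j) * (1 / height l j))"
  let ?P = "{..<m}" and ?Q = "{m..<2 * m}"
  define y where "y X = sgn (spinor l (card (X \<inter> ?P)) (card (X \<inter> ?Q)))" for X
  define c where "c X = 8 * (1 / height l (card (X \<inter> ?P)) * (1 / height l (card (X \<inter> ?Q))))" for X
  have PQ: "?P \<union> ?Q = {..<2 * m}" by auto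
  have unit: "norm (y X) = 1" for X
  proof -
    have "(norm (spinor l (card (X \<inter> ?P)) (card (X \<inter> ?Q))))\<^sup>2 > 0"
      using norm_spinor_ge[of l "card (X \<inter> ?P)" "card (X \<inter> ?Q)"]
        height_ge_1[of l "card (X \<inter> ?P)"] height_ge_1[of l "card (X \<inter> ?Q)"]
      by (smt (verit) mult_pos_pos)
    thus ?thesis by (auto simp: y_def norm_sgn)
  qed
  have cost: "(norm (y (insert x X) - (if vortex_neg l m (x, X) then - y X else y X)))\<^sup>2 \<le> c X"
    if p: "(x, X) \<in> oriented (2 * m)" for x X
  proof (cases "x < m")
    case True
    have "insert x X \<inter> ?P = insert x (X \<inter> ?P)" "insert x X \<inter> ?Q = X \<inter> ?Q" "x \<notin> X"
      using True p by (auto simp: oriented_def)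
    moreover from this have "card (insert x X \<inter> ?P) = Suc (card (X \<inter> ?P))" by simp
    moreover have "\<not> vortex_neg l m (x, X)" using True by (simp add: vortex_neg_def)
    ultimately show ?thesis
      using sgn_spinor_step_le[where b = False, simplified, OF spinor_step_fst[OF assms(1)],
          of "card (X \<inter> ?P)" "card (X \<inter> ?Q)"]
      by (simp add: y_def c_def)
  next
    case False
    have "insert x X \<inter> ?Q = insert x (X \<inter> ?Q)" "insert x X \<inter> ?P = X \<inter> ?P" "x \<notin> X"
      using False p by (auto simp: oriented_def)
    moreover from this have "card (insert x X \<inter> ?Q) = Suc (card (X \<inter> ?Q))" by simp
    moreover have "vortex_neg l m (x, X) \<longleftrightarrow> \<not> even_block l (card (X \<inter> ?P)) \<and>
        even_block l (card (X \<inter> ?Q)) \<noteq> even_block l (Suc (card (X \<inter> ?Q)))"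
      using False by (simp add: vortex_neg_def)
    ultimately show ?thesis
      using sgn_spinor_step_le[OF spinor_step_snd[OF assms(1)], of "card (X \<inter> ?P)" "card (X \<inter> ?Q)"]
      by (simp only: y_def c_def)
  qed
  have cost': "(norm (y (insert (fst p) (snd p)) - (if vortex_neg l m p then - y (snd p) else y (snd p))))\<^sup>2
      \<le> c (snd p)" if "p \<in> oriented (2 * m)" for p
    using cost[of "fst p" "snd p"] that by simp
  have "gw_sdp_value (2 * m) (signing (2 * m) (vortex_neg l m))
      \<le> 1 / (4 * real (2 * m * 2 ^ (2 * m - 1))) * (\<Sum>p\<in>oriented (2 * m).
        (norm (y (insert (fst p) (snd p)) - (if vortex_neg l m p then - y (snd p) else y (snd p))))\<^sup>2)"
    by (rule gw_sdp_value_signing_le[OF unit])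
  also have "\<dots> \<le> 1 / (4 * real (2 * m * 2 ^ (2 * m - 1))) * (\<Sum>p\<in>oriented (2 * m). c (snd p))"
    by (intro mult_left_mono sum_mono cost') auto
  \<comment> \<open>Dropping the condition that \<open>x\<close> lies outside \<open>X\<close> adds
    nonnegative terms and decouples \<open>x\<close> from \<open>X\<close>.\<close>
  also have "\<dots> \<le> 1 / (4 * real (2 * m * 2 ^ (2 * m - 1))) * (\<Sum>p\<in>{..<2 * m} \<times> Pow {..<2 * m}. c (snd p))"
  proof (intro mult_left_mono sum_mono2)
    show "0 \<le> c (snd p)" for p
      using height_ge_1 by (simp add: c_def order_trans[OF zero_le_one])
  qed (auto simp: oriented_def)
  also have "(\<Sum>p\<in>{..<2 * m} \<times> Pow {..<2 * m}. c (snd p)) = 2 * m * (\<Sum>X\<in>Pow (?P \<union> ?Q). c X)"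
    unfolding PQ by (simp add: sum.cartesian_product' split_def)
  also have "(\<Sum>X\<in>Pow (?P \<union> ?Q). c X) = 8 * (S * S)"
    unfolding c_def sum_distrib_left[symmetric]
    by (subst sum_Pow_Un_card) (auto simp: S_def)
  also have "1 / (4 * real (2 * m * 2 ^ (2 * m - 1))) * (2 * m * (8 * (S * S))) = 4 * (S / 2 ^ m)\<^sup>2"
  proof -
    have "(2::real) * 2 ^ (2 * m - 1) = 2 ^ m * 2 ^ m"
      using assms(2) by (simp flip: power_Suc power_add add: mult_2)
    thus ?thesis using assms(2) by (simp add: field_simps power2_eq_square)
  qed
  finally show ?thesis unfolding S_def .
qed

section \<open>Violated edges\<close>

text \<open>The point \<open>(j, k)\<close> of the grid, lifted along the natural ordering of the
  coordinates; its image under \<open>\<pi>\<close> is the lift along the ordering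
  \<open>\<pi>\<close>.\<close>

definition prefix_set :: "nat \<Rightarrow> nat \<Rightarrow> nat \<Rightarrow> nat set" where
  "prefix_set m j k = {..<j} \<union> {m..<m + k}"

lemma prefix_set_flips_fst:
  "j < m \<Longrightarrow> k \<le> m \<Longrightarrow> (j, prefix_set m j k) \<in> flips {..<m} {m..<2 * m} j k"
proof -
  assume *: "j < m" "k \<le> m"
  hence "prefix_set m j k \<inter> {..<m} = {..<j}" "prefix_set m j k \<inter> {m..<2 * m} = {m..<m + k}"
    by (auto simp: prefix_set_def)
  moreover have "prefix_set m j k \<subseteq> {..<m} \<union> {m..<2 * m}" "j \<notin> prefix_set m j k"
    using * by (auto simp: prefix_set_def)
  ultimately show ?thesis using * by (simp add: flips_def subset_Diff_insert)
qed

lemma prefix_set_flips_snd: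
  "j \<le> m \<Longrightarrow> k < m \<Longrightarrow> (m + k, prefix_set m j k) \<in> flips {m..<2 * m} {..<m} k j"
proof -
  assume *: "j \<le> m" "k < m"
  hence "prefix_set m j k \<inter> {..<m} = {..<j}" "prefix_set m j k \<inter> {m..<2 * m} = {m..<m + k}"
    by (auto simp: prefix_set_def)
  moreover have "prefix_set m j k \<subseteq> {m..<2 * m} \<union> {..<m}" "m + k \<notin> prefix_set m j k"
    using * by (auto simp: prefix_set_def)
  ultimately show ?thesis using * by (simp add: flips_def subset_Diff_insert)
qed

definition violated :: "nat \<Rightarrow> nat \<Rightarrow> (nat set \<Rightarrow> bool) \<Rightarrow> (nat \<times> nat set) set" where
  "violated l m \<phi> = {p \<in> oriented (2 * m).
     (\<phi> (snd p) \<noteq> \<phi> (insert (fst p) (snd p))) \<noteq> vortex_neg l m p}"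

lemma eq_by_steps:
  fixes \<psi> :: "nat \<Rightarrow> bool"
  assumes "\<And>t. t < n \<Longrightarrow> \<psi> (i + t) = \<psi> (i + Suc t)"
  shows "\<psi> i = \<psi> (i + n)"
  using assms by (induction n) auto

text \<open>If no boundary edge were violated, \<open>f\<close> would be constant along the two
  sides in the first direction and \<open>g\<close> along the two others. But \<open>f\<close> and
  \<open>g\<close> differ at exactly one of the four corners, the one with odd first and even second
  block, which is a parity contradiction.\<close>

lemma odd_square_has_violated_edge:
  assumes l: "l > 0" and \<pi>: "\<pi> \<in> block_perms {..<m} {m..<2 * m}"
    and jk: "j + l \<le> m" "k + l \<le> m"
  shows "\<exists>t<l. (\<pi> (j + t), \<pi> ` prefix_set m (j + t) k) \<in> violated l m \<phi>
     \<or> (\<pi> (j + t), \<pi> ` prefix_set m (j + t) (k + l)) \<in> violated l m \<phi>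
     \<or> (\<pi> (m + (k + t)), \<pi> ` prefix_set m j (k + t)) \<in> violated l m \<phi>
     \<or> (\<pi> (m + (k + t)), \<pi> ` prefix_set m (j + l) (k + t)) \<in> violated l m \<phi>"
proof (rule ccontr)
  let ?P = "{..<m}" and ?Q = "{m..<2 * m}"
  define f where "f a b = \<phi> (\<pi> ` prefix_set m a b)" for a b
  \<comment> \<open>The gauge change turning the signed columns into columns of equality edges.\<close>
  define g where "g a b = (f a b \<noteq> (\<not> even_block l a \<and> even_block l b))" for a b
  assume "\<not> ?thesis"
  hence good: "(\<pi> (j + t), \<pi> ` prefix_set m (j + t) k) \<notin> violated l m \<phi>"
     "(\<pi> (j + t), \<pi> ` prefix_set m (j + t) (k + l)) \<notin> violated l m \<phi>"
     "(\<pi> (m + (k + t)), \<pi> ` prefix_set m j (k + t)) \<notin> violated l m \<phi>"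
     "(\<pi> (m + (k + t)), \<pi> ` prefix_set m (j + l) (k + t)) \<notin> violated l m \<phi>" if "t < l" for t
    using that by auto
  have PQ: "?P \<union> ?Q = {..<2 * m}" "?Q \<union> ?P = {..<2 * m}" by auto
  have stepA: "f a b = f (Suc a) b"
    if "(\<pi> a, \<pi> ` prefix_set m a b) \<notin> violated l m \<phi>" "a < m" "b \<le> m" for a b
  proof -
    have fl: "(\<pi> a, \<pi> ` prefix_set m a b) \<in> flips ?P ?Q a b"
      by (rule block_perms_flips[OF \<pi> prefix_set_flips_fst[OF that(2,3)]])
    have "(\<pi> a, \<pi> ` prefix_set m a b) \<in> oriented (2 * m)"
      using fl by (auto simp: flips_def oriented_def)
    moreover have "\<not> vortex_neg l m (\<pi> a, \<pi> ` prefix_set m a b)"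
      using fl by (simp add: vortex_neg_def flips_def)
    moreover have "prefix_set m (Suc a) b = insert a (prefix_set m a b)"
      by (auto simp: prefix_set_def)
    hence "insert (\<pi> a) (\<pi> ` prefix_set m a b) = \<pi> ` prefix_set m (Suc a) b"
      by simp
    ultimately show ?thesis using that(1) by (simp add: violated_def f_def)
  qed
  have stepB: "g a b = g a (Suc b)"
    if "(\<pi> (m + b), \<pi> ` prefix_set m a b) \<notin> violated l m \<phi>" "a \<le> m" "b < m" for a b
  proof -
    have "\<pi> \<in> block_perms ?Q ?P" using \<pi> block_perms_commute by blast
    from block_perms_flips[OF this prefix_set_flips_snd[OF that(2,3)]]
    have fl: "(\<pi> (m + b), \<pi> ` prefix_set m a b) \<in> flips ?Q ?P b a" .
    have "(\<pi> (m + b), \<pi> ` prefix_set m a b) \<in> oriented (2 * m)"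
      using fl by (auto simp: flips_def oriented_def)
    moreover have "vortex_neg l m (\<pi> (m + b), \<pi> ` prefix_set m a b)
        \<longleftrightarrow> \<not> even_block l a \<and> even_block l b \<noteq> even_block l (Suc b)"
      using fl by (simp add: vortex_neg_def flips_def)
    moreover have "prefix_set m a (Suc b) = insert (m + b) (prefix_set m a b)"
      by (auto simp: prefix_set_def)
    hence "insert (\<pi> (m + b)) (\<pi> ` prefix_set m a b) = \<pi> ` prefix_set m a (Suc b)"
      by simp
    ultimately show ?thesis using that(1) by (auto simp: violated_def f_def g_def)
  qed
  have "f j k = f (j + l) k"
    using stepA good(1) jk by (intro eq_by_steps[of l "\<lambda>a. f a k"]) auto
  moreover have "f j (k + l) = f (j + l) (k + l)"
    using stepA good(2) jk by (intro eq_by_steps[of l "\<lambda>a. f a (k + l)"]) auto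
  moreover have "g j k = g j (k + l)"
    using stepB good(3) jk by (intro eq_by_steps[of l "g j"]) auto
  moreover have "g (j + l) k = g (j + l) (k + l)"
    using stepB good(4) jk by (intro eq_by_steps[of l "g (j + l)"]) auto
  ultimately show False
    using even_block_add[OF l, of j] even_block_add[OF l, of k] unfolding g_def by blast
qed

section \<open>Double counting of squares and orderings\<close>

lemma sum_card_Int_flips_le:
  assumes "finite B" "finite J"
  shows "(\<Sum>j\<in>J. \<Sum>k\<in>J. card (B \<inter> flips P Q (j + a) (k + b))) \<le> card B"
proof -
  have "(\<Sum>j\<in>J. \<Sum>k\<in>J. card (B \<inter> flips P Q (j + a) (k + b)))
      = (\<Sum>q\<in>J \<times> J. card (B \<inter> flips P Q (fst q + a) (snd q + b)))"
    by (simp add: sum.cartesian_product split_def)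
  \<comment> \<open>Distinct pairs of indices give distinct levels, hence disjoint sets.\<close>
  also have "\<dots> = card (\<Union>q\<in>J \<times> J. B \<inter> flips P Q (fst q + a) (snd q + b))"
    using assms by (intro card_UN_disjoint[symmetric]) (auto simp: flips_def)
  also have "\<dots> \<le> card B"
    using assms by (intro card_mono) auto
  finally show ?thesis .
qed

text \<open>Under each ordering every square with corner in \<open>J \<times> J\<close> shows a
  violated edge at one of its \<open>4 * l\<close> boundary positions. A position is violated with
  the frequency of violated edges in its level, and weighting the square by
  \<open>w j * w k * m\<close>, at most the size of that level, leaves at most the number of
  violated edges there. Summed over the squares, one position meets disjoint levels and so accounts
  for at most \<open>card B\<close>.\<close>

lemma card_violated_ge:
  assumes l: "l > 0" and m: "m = 2 * h + 1"
  shows "m * (\<Sum>i=h + l..2 * h. (2 * h) choose i)\<^sup>2 \<le> 4 * l * card (violated l m \<phi>)"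
proof -
  let ?P = "{..<m}" and ?Q = "{m..<2 * m}"
  define B where "B = violated l m \<phi>"
  define G where "G = block_perms ?P ?Q"
  \<comment> \<open>Corners whose squares stay between levels \<open>h\<close> and
    \<open>2 * h\<close>; as \<open>m - 1 = 2 * h\<close>, the row of \<open>card_flips\<close> is
    centred at \<open>h\<close>.\<close>
  define J where "J = {j. h \<le> j \<and> j + l \<le> 2 * h}"
  \<comment> \<open>Above the middle level the binomial coefficients decrease, so \<open>w j\<close> is a lower bound for all
    levels from \<open>j\<close> to \<open>j + l\<close> and squares can be weighted uniformly along their boundary.\<close>
  define w where "w j = (2 * h) choose (j + l)" for j
  define NA where "NA j k = card {\<pi> \<in> G. (\<pi> j, \<pi> ` prefix_set m j k) \<in> B}" for j k
  define NB where "NB j k = card {\<pi> \<in> G. (\<pi> (m + k), \<pi> ` prefix_set m j k) \<in> B}" for j k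
  define bA where "bA j k = card (B \<inter> flips ?P ?Q j k)" for j k
  define bB where "bB j k = card (B \<inter> flips ?Q ?P k j)" for j k
  have finB: "finite B" unfolding B_def violated_def using finite_oriented by auto
  have finG: "finite G" unfolding G_def by (intro finite_block_perms) auto
  have finJ: "finite J" unfolding J_def by (rule finite_subset[of _ "{..2 * h}"]) auto
  have "card G > 0" using finG id_in_block_perms unfolding G_def by (auto simp: card_gt_0_iff)
  have m1: "m - Suc 0 = 2 * h" using m by simp
  have disj: "?P \<inter> ?Q = {}" "?Q \<inter> ?P = {}" by auto
  have hitA: "NA j k * (m * ((2 * h) choose j) * (m choose k)) = card G * bA j k"
    if "j < m" "k \<le> m" for j k
    using card_block_perms_hit[OF _ _ disj(1) prefix_set_flips_fst[OF that], of B]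
    by (simp add: m1 card_flips[OF _ _ disj(1)] NA_def bA_def G_def)
  have hitB: "NB j k * (m * ((2 * h) choose k) * (m choose j)) = card G * bB j k"
    if "j \<le> m" "k < m" for j k
    using card_block_perms_hit[OF _ _ disj(2) prefix_set_flips_snd[OF that], of B]
    by (simp add: m1 card_flips[OF _ _ disj(2)] NB_def bB_def G_def block_perms_commute[of ?Q ?P])
  have w_le: "w j \<le> (2 * h) choose i" "w j \<le> m choose i" if "j \<in> J" "j \<le> i" "i \<le> j + l" for i j
  proof -
    show "w j \<le> (2 * h) choose i"
      unfolding w_def using that by (intro binomial_antimono) (auto simp: J_def)
    also have "\<dots> \<le> m choose i" unfolding m by (cases i) auto
    finally show "w j \<le> m choose i" .
  qed
  have A: "w j * w k * m * NA (j + s) (k + t) \<le> card G * bA (j + s) (k + t)"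
    if "j \<in> J" "k \<in> J" "s \<le> l" "t \<le> l" for j k s t
  proof -
    have "w j * w k * m * NA (j + s) (k + t)
        \<le> ((2 * h) choose (j + s)) * (m choose (k + t)) * m * NA (j + s) (k + t)"
      using w_le that by (intro mult_le_mono) auto
    also have "\<dots> = card G * bA (j + s) (k + t)"
    proof -
      have "j + s < m" "k + t \<le> m" using that by (auto simp: J_def m)
      from hitA[OF this] show ?thesis by (simp only: mult_ac)
    qed
    finally show ?thesis .
  qed
  have B: "w j * w k * m * NB (j + s) (k + t) \<le> card G * bB (j + s) (k + t)"
    if "j \<in> J" "k \<in> J" "s \<le> l" "t \<le> l" for j k s t
  proof -
    have "w j * w k * m * NB (j + s) (k + t)
        \<le> (m choose (j + s)) * ((2 * h) choose (k + t)) * m * NB (j + s) (k + t)"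
      using w_le that by (intro mult_le_mono) auto
    also have "\<dots> = card G * bB (j + s) (k + t)"
    proof -
      have "j + s \<le> m" "k + t < m" using that by (auto simp: J_def m)
      from hitB[OF this] show ?thesis by (simp only: mult_ac)
    qed
    finally show ?thesis .
  qed
  have cover: "card G \<le> (\<Sum>t<l. NA (j + t) k + NA (j + t) (k + l) + NB j (k + t) + NB (j + l) (k + t))"
    if "j \<in> J" "k \<in> J" for j k
  proof -
    let ?A = "\<lambda>a b. {\<pi> \<in> G. (\<pi> a, \<pi> ` prefix_set m a b) \<in> B}"
    let ?B = "\<lambda>a b. {\<pi> \<in> G. (\<pi> (m + b), \<pi> ` prefix_set m a b) \<in> B}"
    have "G \<subseteq> (\<Union>t<l. ?A (j + t) k \<union> ?A (j + t) (k + l) \<union> ?B j (k + t) \<union> ?B (j + l) (k + t))"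
      (is "_ \<subseteq> (\<Union>t<l. ?U t)")
    proof
      fix \<pi> assume \<pi>: "\<pi> \<in> G"
      have "j + l \<le> m" "k + l \<le> m" using that by (auto simp: J_def m)
      from odd_square_has_violated_edge[OF l \<pi>[unfolded G_def] this, of \<phi>]
      show "\<pi> \<in> (\<Union>t<l. ?U t)" using \<pi> unfolding B_def by blast
    qed
    hence "card G \<le> card (\<Union>t<l. ?U t)"
      using finG by (intro card_mono) auto
    also have "\<dots> \<le> (\<Sum>t<l. card (?U t))" by (rule card_UN_le) auto
    also have "\<dots> \<le> (\<Sum>t<l. NA (j + t) k + NA (j + t) (k + l) + NB j (k + t) + NB (j + l) (k + t))"
      unfolding NA_def NB_def by (intro sum_mono order_trans[OF card_Un_le] add_mono order.refl)
    finally show ?thesis .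
  qed
  have sumA: "(\<Sum>j\<in>J. \<Sum>k\<in>J. bA (j + s) (k + t)) \<le> card B" for s t
    unfolding bA_def by (rule sum_card_Int_flips_le[OF finB finJ])
  have sumB: "(\<Sum>j\<in>J. \<Sum>k\<in>J. bB (j + s) (k + t)) \<le> card B" for s t
    unfolding bB_def by (subst sum.swap) (rule sum_card_Int_flips_le[OF finB finJ])
  have "card G * (m * (\<Sum>j\<in>J. w j)\<^sup>2) = (\<Sum>j\<in>J. \<Sum>k\<in>J. w j * w k * m * card G)"
    by (simp add: power2_eq_square sum_product sum_distrib_left sum_distrib_right mult_ac)
  \<comment> \<open>The \<open>+ 0\<close> gives all four sides of the square the shape required by
    \<open>A\<close>, \<open>B\<close>, \<open>sumA\<close> and \<open>sumB\<close>.\<close>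
  also have "\<dots> \<le> (\<Sum>j\<in>J. \<Sum>k\<in>J. \<Sum>t<l. card G *
      (bA (j + t) (k + 0) + bA (j + t) (k + l) + bB (j + 0) (k + t) + bB (j + l) (k + t)))"
  proof (intro sum_mono)
    fix j k assume jk: "j \<in> J" "k \<in> J"
    have "w j * w k * m * card G \<le> w j * w k * m *
        (\<Sum>t<l. NA (j + t) k + NA (j + t) (k + l) + NB j (k + t) + NB (j + l) (k + t))"
      using cover[OF jk] by (intro mult_le_mono2)
    also have "\<dots> = (\<Sum>t<l. w j * w k * m * NA (j + t) (k + 0) + w j * w k * m * NA (j + t) (k + l)
        + w j * w k * m * NB (j + 0) (k + t) + w j * w k * m * NB (j + l) (k + t))"
      by (simp add: sum_distrib_left distrib_left)
    also have "\<dots> \<le> (\<Sum>t<l. card G * (bA (j + t) (k + 0) + bA (j + t) (k + l)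
        + bB (j + 0) (k + t) + bB (j + l) (k + t)))"
      unfolding distrib_left by (intro sum_mono add_mono A B jk) auto
    finally show "w j * w k * m * card G \<le> \<dots>" .
  qed
  also have "\<dots> = (\<Sum>t<l. card G * ((\<Sum>j\<in>J. \<Sum>k\<in>J. bA (j + t) (k + 0)) + (\<Sum>j\<in>J. \<Sum>k\<in>J. bA (j + t) (k + l))
      + (\<Sum>j\<in>J. \<Sum>k\<in>J. bB (j + 0) (k + t)) + (\<Sum>j\<in>J. \<Sum>k\<in>J. bB (j + l) (k + t))))"
    unfolding sum.distrib[symmetric] sum_distrib_left
    by (subst sum.swap[of _ "{..<l}"], subst sum.swap[of _ "{..<l}"]) (rule refl)
  also have "\<dots> \<le> (\<Sum>t<l. card G * (card B + card B + card B + card B))"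
    by (intro sum_mono mult_le_mono2 add_mono sumA sumB)
  also have "\<dots> = card G * (4 * l * card B)" by simp
  finally have "m * (\<Sum>j\<in>J. w j)\<^sup>2 \<le> 4 * l * card B"
    using \<open>card G > 0\<close> by simp
  moreover have "(\<Sum>j\<in>J. w j) = (\<Sum>i=h + l..2 * h. (2 * h) choose i)"
    by (rule sum.reindex_bij_witness[of _ "\<lambda>i. i - l" "\<lambda>j. j + l"]) (auto simp: J_def w_def)
  ultimately show ?thesis by (simp add: B_def)
qed

text \<open>The cube has \<open>m * (2 ^ m * 2 ^ m)\<close> edges, so the factor \<open>m\<close> of
  \<open>card_violated_ge\<close> cancels.\<close>

lemma combinatorial_value_vortex_ge:
  assumes l: "l > 0" and m: "m = 2 * h + 1"
  shows "combinatorial_value (2 * m) (signing (2 * m) (vortex_neg l m))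
     \<ge> ((\<Sum>i=h + l..2 * h. real ((2 * h) choose i)) / 2 ^ m)\<^sup>2 / (4 * l)"
proof -
  define W where "W = (\<Sum>i=h + l..2 * h. (2 * h) choose i)"
  have "(real W / 2 ^ m)\<^sup>2 / (4 * l) \<le> unsat_fraction (2 * m) (signing (2 * m) (vortex_neg l m)) \<sigma>"
    if \<sigma>: "\<sigma> \<in> assignments (2 * m)" for \<sigma>
  proof -
    define \<phi> where "\<phi> X = (\<sigma> (indicator_vertex (2 * m) X) = 1)" for X
    have "\<sigma> (indicator_vertex (2 * m) X) \<in> {0, 1}" for X
      using \<sigma> indicator_vertex_in_hc_verts by (auto simp: assignments_def PiE_iff)
    hence eq: "\<sigma> (indicator_vertex (2 * m) X) \<noteq> \<sigma> (indicator_vertex (2 * m) Y) \<longleftrightarrow> \<phi> X \<noteq> \<phi> Y" for X Y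
      unfolding \<phi>_def by (metis empty_iff insert_iff zero_neq_one)
    have "m * W\<^sup>2 \<le> 4 * l * card (violated l m \<phi>)"
      unfolding W_def by (rule card_violated_ge[OF l m])
    hence le: "real m * (real W)\<^sup>2 \<le> 4 * l * real (card (violated l m \<phi>))"
      by (metis (mono_tags, lifting) of_nat_le_iff of_nat_mult of_nat_numeral of_nat_power)
    have two: "(2::real) * 2 ^ (2 * m - 1) = 2 ^ m * 2 ^ m"
      using m by (simp flip: power_Suc power_add add: mult_2)
    have "m > 0" using m by simp
    have "real (2 * m) * 2 ^ (2 * m - 1) = real m * (2 * 2 ^ (2 * m - 1))" by simp
    hence den: "real (2 * m) * 2 ^ (2 * m - 1) = real (m * (2 ^ m * 2 ^ m))"
      unfolding two by simp
    have "(real W / 2 ^ m)\<^sup>2 / (4 * l) = (real m * (real W)\<^sup>2) / (4 * l * (m * (2 ^ m * 2 ^ m)))"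
      using \<open>m > 0\<close> l by (simp add: field_simps power2_eq_square)
    also have "\<dots> \<le> (4 * l * real (card (violated l m \<phi>))) / (4 * l * (m * (2 ^ m * 2 ^ m)))"
      using le by (intro divide_right_mono) auto
    also have "\<dots> = real (card (violated l m \<phi>)) / (m * (2 ^ m * 2 ^ m))"
      using l by simp
    also have "\<dots> = unsat_fraction (2 * m) (signing (2 * m) (vortex_neg l m)) \<sigma>"
      unfolding unsat_fraction_signing eq violated_def den ..
    finally show ?thesis .
  qed
  thus ?thesis
    unfolding combinatorial_value_def W_def
    using finite_assignments assignments_nonempty by (subst Min_ge_iff) auto
qed

section \<open>Choice of the block length and of the dimensions\<close>

theorem theorem3p2:
  shows "\<exists>c C \<epsilon>\<^sub>0 :: real. c > 0 \<and> C > 0 \<and> \<epsilon>\<^sub>0 > 0 \<and>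
    (\<forall>\<epsilon>. 0 < \<epsilon> \<and> \<epsilon> < \<epsilon>\<^sub>0 \<longrightarrow>
      (\<exists>F :: (nat \<times> (vertex set \<Rightarrow> nat)) set.
         infinite F \<and>
         (\<forall>(d, I) \<in> F. I \<in> lin2_instances d \<and>
            combinatorial_value d I \<ge> c * \<epsilon> \<and>
            gw_sdp_value d I \<le> C * \<epsilon> powr (3 / 2))))"
\<comment> \<open>The value is at least (1/8)^2 / (4l) = 1 / (256 l), and l <= 2 / \<epsilon>, which
  uses \<epsilon> < 1. The constant 324 is 4 times the square of 9, from the bound
  \<open>9 * r\<close> below.\<close>
proof (rule exI[of _ "1 / 512"], rule exI[of _ 324], rule exI[of _ 1], intro conjI allI impI)
  fix \<epsilon> :: real assume \<epsilon>: "0 < \<epsilon> \<and> \<epsilon> < 1"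
  define l where "l = nat \<lceil>1 / \<epsilon>\<rceil>"
  \<comment> \<open>Then \<open>l * \<delta>\<close> is 1 / (4l): at most 1/4, so that a quarter of
    the row survives in the tail, and at most 1 / l, so that the equidistribution error is
    negligible.\<close>
  define \<delta> where "\<delta> = 1 / (4 * (real l)\<^sup>2)"
  have "1 / \<epsilon> > 1" using \<epsilon> by simp
  hence l: "1 / \<epsilon> \<le> l" "l \<le> 2 / \<epsilon>" "l > 0" unfolding l_def by linarith+
  have "\<delta> > 0" using l by (simp add: \<delta>_def)
  from eventually_central_binomial_le[OF this] obtain h0 where
    h0: "\<And>h. h \<ge> h0 \<Longrightarrow> real ((2 * h) choose h) \<le> \<delta> * 4 ^ h"
    by (auto simp: eventually_sequentially)
  define inst where "inst h = (2 * (2 * h + 1), signing (2 * (2 * h + 1)) (vortex_neg l (2 * h + 1)))" for h :: nat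
  \<comment> \<open>Distinct \<open>h\<close> give distinct dimensions.\<close>
  have "inj_on inst {h0..}" by (auto simp: inj_on_def inst_def)
  hence inf: "infinite (inst ` {h0..})"
    using infinite_Ici finite_imageD by blast
  have value_ge: "combinatorial_value (fst (inst h)) (snd (inst h)) \<ge> 1 / 512 * \<epsilon>" if "h \<ge> h0" for h
  proof -
    define m where "m = 2 * h + 1"
    have pow: "(2::real) ^ m = 2 * 4 ^ h" by (simp add: m_def power_mult)
    have "l * real ((2 * h) choose h) \<le> l * (\<delta> * 4 ^ h)"
      using h0[OF that] by (intro mult_left_mono) auto
    also have "\<dots> = (1 / real l) * (4 ^ h / 4)"
      using l by (simp add: \<delta>_def power2_eq_square)
    also have "\<dots> \<le> 1 * (4 ^ h / 4)"
      using l by (intro mult_right_mono) auto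
    finally have "4 ^ h / 4 \<le> (\<Sum>i=h + l..2 * h. real ((2 * h) choose i))"
      using sum_binomial_upper_tail_ge[of h l] by linarith
    hence "1 / 8 \<le> (\<Sum>i=h + l..2 * h. real ((2 * h) choose i)) / 2 ^ m"
      unfolding pow by (simp add: field_simps)
    hence "(1 / 8)\<^sup>2 \<le> ((\<Sum>i=h + l..2 * h. real ((2 * h) choose i)) / 2 ^ m)\<^sup>2"
      by (intro power_mono) auto
    hence "(1 / 8)\<^sup>2 / (4 * l) \<le> ((\<Sum>i=h + l..2 * h. real ((2 * h) choose i)) / 2 ^ m)\<^sup>2 / (4 * l)"
      by (intro divide_right_mono) auto
    also have "\<dots> \<le> combinatorial_value (fst (inst h)) (snd (inst h))"
      using combinatorial_value_vortex_ge[OF l(3) m_def] by (simp add: inst_def m_def)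
    finally have "1 / (256 * l) \<le> combinatorial_value (fst (inst h)) (snd (inst h))"
      by (simp add: power2_eq_square)
    moreover have "1 / 512 * \<epsilon> \<le> 1 / (256 * l)"
      using l \<epsilon> by (simp add: field_simps)
    ultimately show ?thesis by linarith
  qed
  have gw_le: "gw_sdp_value (fst (inst h)) (snd (inst h)) \<le> 324 * \<epsilon> powr (3 / 2)" if "h \<ge> h0" for h
  proof -
    define m where "m = 2 * h + 1"
    define S where "S = (\<Sum>j\<le>m. real (m choose j) * (1 / height l j))"
    define r where "r = real l powr (- (3 / 4))"
    have inverse_height: "0 \<le> 1 / height l j" "1 / height l j \<le> 1" for j
      using height_ge_1[of l j] by (auto simp: field_simps)
    \<comment> \<open>Pascal's rule: the two summands are at most the central coefficient of row
      \<open>2 * h\<close>.\<close>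
    have "m choose (m div 2) \<le> 2 * ((2 * h) choose h)"
      using binomial_maximum'[of h "h - 1"] by (cases h) (auto simp: m_def)
    hence "real (m choose (m div 2)) \<le> 2 * (\<delta> * 4 ^ h)"
      using h0[OF that] by linarith
    also have "\<dots> = \<delta> * 2 ^ m" by (simp add: m_def power_mult)
    finally have "l * real (m choose (m div 2)) \<le> l * (\<delta> * 2 ^ m)"
      by (intro mult_left_mono) auto
    moreover have "S \<le> 2 ^ m * ((\<Sum>t<l. 1 / height l t) / l) + l * real (m choose (m div 2))"
      unfolding S_def
      by (rule sum_binomial_periodic_le) (use inverse_height height_periodic l in auto)
    ultimately have "S / 2 ^ m \<le> (\<Sum>t<l. 1 / height l t) / l + l * \<delta>"
      by (simp add: field_simps)
    also have "(\<Sum>t<l. 1 / height l t) / l \<le> 2 * (4 * real l powr (1 / 4)) / l"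
      using sum_inverse_height_le[of l] sum_inverse_le_powr[OF l(3)]
      by (intro divide_right_mono) auto
    also have "\<dots> = 8 * (real l powr (1 / 4) * real l powr (- 1))"
      using l by (simp add: powr_minus_divide)
    also have "\<dots> = 8 * r" unfolding r_def powr_add[symmetric] by simp
    \<comment> \<open>The error is absorbed into one further \<open>r\<close>, since
      \<open>l\<close> is at least 1.\<close>
    also have "l * \<delta> \<le> real l powr (- 1)"
      using l by (simp add: \<delta>_def power2_eq_square powr_minus_divide field_simps)
    also have "\<dots> \<le> r" unfolding r_def using l by (intro powr_mono) auto
    finally have "S / 2 ^ m \<le> 9 * r" by simp
    moreover have "S \<ge> 0" unfolding S_def using inverse_height
      by (intro sum_nonneg mult_nonneg_nonneg) auto
    ultimately have "(S / 2 ^ m)\<^sup>2 \<le> (9 * r)\<^sup>2" by (intro power_mono) auto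
    hence "4 * (S / 2 ^ m)\<^sup>2 \<le> 324 * (r * r)" by (simp add: power2_eq_square)
    also have "r * r = real l powr (- (3 / 2))" unfolding r_def powr_add[symmetric] by simp
    also have "real l powr (- (3 / 2)) \<le> (1 / \<epsilon>) powr (- (3 / 2))"
      using l \<epsilon> by (intro powr_mono2') auto
    also have "(1 / \<epsilon>) powr (- (3 / 2)) = \<epsilon> powr (3 / 2)"
      using \<epsilon> by (simp add: powr_divide powr_minus_divide)
    finally have "4 * (S / 2 ^ m)\<^sup>2 \<le> 324 * \<epsilon> powr (3 / 2)" by simp
    moreover have "gw_sdp_value (fst (inst h)) (snd (inst h)) \<le> 4 * (S / 2 ^ m)\<^sup>2"
      using gw_sdp_value_vortex_le[OF l(3), of m] by (simp add: inst_def m_def S_def)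
    ultimately show ?thesis by linarith
  qed
  show "\<exists>F. infinite F \<and> (\<forall>(d, I) \<in> F. I \<in> lin2_instances d \<and>
      combinatorial_value d I \<ge> 1 / 512 * \<epsilon> \<and> gw_sdp_value d I \<le> 324 * \<epsilon> powr (3 / 2))"
  proof (intro exI[of _ "inst ` {h0..}"] conjI inf ballI)
    fix q assume "q \<in> inst ` {h0..}"
    then obtain h where "h \<ge> h0" "q = inst h" by auto
    thus "case q of (d, I) \<Rightarrow> I \<in> lin2_instances d \<and>
      combinatorial_value d I \<ge> 1 / 512 * \<epsilon> \<and> gw_sdp_value d I \<le> 324 * \<epsilon> powr (3 / 2)"
      using value_ge[of h] gw_le[of h] signing_in_lin2_instances by (simp add: inst_def)
  qed
qed auto

end
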